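(* Let $(\theta_n)_{n\geqslant 0}$ be the stochastic gradient recursion described in the context, for a function $f$ and random functions $f_n$ satisfying all of the assumptions (A1)–(A7) listed there with a constant $R>0$. Let $N \geqslant 1$ be an integer and assume the step size is constant, $\gamma_n=\gamma = \frac{1}{2R^2\sqrt{N}}$ for all $n$. Let $\mu>0$ be the lowest eigenvalue of the Hessian $f''(\theta_\ast)$ of $f$ at the unique global optimum $\theta_\ast$, and let $\bar\theta_N=\frac1N\sum_{k=0}^{N-1}\theta_k$. Then $$\mathbb{E} f(\bar{\theta}_N) - f(\theta_\ast) \leqslant \frac{R^2}{N\mu}\big( 5R \|\theta_0-\theta_\ast\| + 15\big)^4,$$ $$\mathbb{E}\big\|\bar{\theta}_N-\theta_\ast\big\|^2 \leqslant \frac{R^2}{N\mu^2}\big( 6R \|\theta_0-\theta_\ast\| + 21\big)^4 .$$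
   Context: $\mathcal{H}$ is a real Hilbert space with inner product $\langle\cdot,\cdot\rangle$ and norm $\|\cdot\|$, identified with its dual, so that gradients of functions on $\mathcal{H}$ are elements of $\mathcal{H}$. $f:\mathcal{H}\to\mathbb{R}$ is a function, $(\mathcal{F}_n)$ is an increasing family of $\sigma$-fields on a probability space ($\mathcal{F}_0$ being trivial), $\theta_0\in\mathcal{H}$ is deterministic, and $f_n:\mathcal{H}\to\mathbb{R}$, $n\geqslant 1$, is a sequence of random differentiable functions. For a certain $R>0$, the assumptions are: (A1) $f$ is convex and three-times differentiable. (A2) (Generalized self-concordance) For all $\theta_1,\theta_2\in\mathcal{H}$, the function $\varphi:t\mapsto f[\theta_1+t(\theta_2-\theta_1)]$ satisfies $|\varphi'''(t)|\leqslant R\|\theta_1-\theta_2\|\varphi''(t)$ for all $t\in\mathbb{R}$. (A3) $f$ has a global minimum attained at $\theta_\ast\in\mathcal{H}$. (A4) For all $\theta\in\mathcal{H}$, $\|f'(\theta)\|\leqslant R$ and, for all $n\geqslant 1$, $\|f_n'(\theta)\|\leqslant R$ almost surely. (A5) For all $n\geqslant 1$, $f_n$ is $\mathcal{F}_n$-measurable. (A6) For all $n\geqslant 1$, $\mathbb{E}(f_n'(\theta_{n-1})\mid\mathcal{F}_{n-1})=f'(\theta_{n-1})$. (A7) For all $n\geqslant 1$, $\theta_n=\theta_{n-1}-\gamma_n f_n'(\theta_{n-1})$, where $(\gamma_n)_{n\geqslant 1}$ is a deterministic sequence. The lowest eigenvalue of the self-adjoint operator $f''(\theta_\ast)$ is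 understood as $\inf_{\|h\|=1}\langle h,f''(\theta_\ast)h\rangle$. *)

theory Defs
  imports "HOL-Probability.Probability"
begin

text \<open>
  A real Hilbert space is a type of sort \<open>{real_inner, complete_space}\<close>; no separability is assumed.
\<close>

section \<open>Gradient and Hessian\<close>

definition gradient :: "('h::{real_inner, complete_space} \<Rightarrow> real) \<Rightarrow> 'h \<Rightarrow> 'h" where
  "gradient f x = (THE D. GDERIV f x :> D)"

definition hessian :: "('h::{real_inner, complete_space} \<Rightarrow> real) \<Rightarrow> 'h \<Rightarrow> ('h \<Rightarrow>\<^sub>L 'h)" where
  "hessian f x = Blinfun (frechet_derivative (gradient f) (at x))"

text \<open>
  All derivatives are Frechet derivatives; the last clause is differentiability of the second
  derivative with respect to the operator norm.
\<close>

definition three_times_differentiable :: "('h::{real_inner, complete_space} \<Rightarrow> real) \<Rightarrow> bool" where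
  "three_times_differentiable f \<longleftrightarrow>
     (\<forall>x. f differentiable (at x) \<and> gradient f differentiable (at x) \<and> hessian f differentiable (at x))"

definition lowest_eigenvalue :: "('h::real_inner \<Rightarrow>\<^sub>L 'h) \<Rightarrow> real" where
  "lowest_eigenvalue A = (INF h\<in>{h. norm h = 1}. inner h (blinfun_apply A h))"

text \<open>
  Riesz representation: on a Hilbert space every differentiable real function has a gradient,
  so \<open>gradient\<close> is meaningful under the hypothesis \<open>differentiable\<close>.
\<close>

lemma riesz_representation:
  fixes g :: "'h::{real_inner, complete_space} \<Rightarrow> real"
  assumes "bounded_linear g"
  shows "\<exists>D. \<forall>h. g h = inner h D"
proof -
  interpret g: bounded_linear g by fact
  obtain K where K: "\<And>x. norm (g x) \<le> norm x * K"
    using g.bounded by blast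
  define J where "J x = inner x x / 2 - g x" for x
  have low: "- (K\<^sup>2 / 2) \<le> J x" for x
  proof -
    have "g x \<le> norm x * K" using K[of x] by simp
    moreover have "0 \<le> (norm x - K)\<^sup>2" by simp
    ultimately show ?thesis
      unfolding J_def power2_norm_eq_inner[symmetric] by (simp add: power2_diff field_simps)
  qed
  have bdd: "bdd_below (range J)" using low by (auto intro!: bdd_belowI)
  define m where "m = Inf (range J)"
  have m_le: "m \<le> J x" for x unfolding m_def using bdd by (auto intro: cInf_lower)
  have "\<exists>x. J x < m + inverse (real (Suc n))" for n
    using cInf_lessD[of "range J" "m + inverse (real (Suc n))"] unfolding m_def by auto
  then obtain x where x: "\<And>n. J (x n) < m + inverse (real (Suc n))" by metis
  have para: "J a + J b - 2 * J ((1/2) *\<^sub>R (a + b)) = (norm (a - b))\<^sup>2 / 4" for a b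
    unfolding J_def power2_norm_eq_inner
    by (simp add: g.add g.scaleR inner_add_left inner_add_right inner_diff_left
        inner_diff_right inner_commute field_simps)
  have "Cauchy x"
  proof (rule metric_CauchyI)
    fix e :: real assume e: "0 < e"
    obtain n0 where n0: "inverse (real (Suc n0)) < e\<^sup>2 / 8"
      using reals_Archimedean[of "e\<^sup>2 / 8"] e by auto
    have "dist (x i) (x j) < e" if "i \<ge> n0" "j \<ge> n0" for i j
    proof -
      have small: "inverse (real (Suc k)) < e\<^sup>2 / 8" if "k \<ge> n0" for k
        using n0 that by (smt (verit) le_imp_inverse_le of_nat_0_less_iff of_nat_mono Suc_le_mono zero_less_Suc)
      have "(norm (x i - x j))\<^sup>2 / 4 = J (x i) + J (x j) - 2 * J ((1/2) *\<^sub>R (x i + x j))"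
        using para by simp
      also have "\<dots> < e\<^sup>2 / 4"
        using x[of i] x[of j] m_le[of "(1/2) *\<^sub>R (x i + x j)"] small[OF that(1)] small[OF that(2)]
        by linarith
      finally have "(norm (x i - x j))\<^sup>2 < e\<^sup>2" by simp
      then show ?thesis using e by (auto simp: dist_norm intro: power_less_imp_less_base)
    qed
    then show "\<exists>M. \<forall>i\<ge>M. \<forall>j\<ge>M. dist (x i) (x j) < e" by blast
  qed
  then obtain D where D: "x \<longlonglongrightarrow> D" using Cauchy_convergent convergent_def by blast
  have "(\<lambda>n. J (x n)) \<longlonglongrightarrow> J D"
    unfolding J_def by (intro tendsto_diff tendsto_divide tendsto_inner tendsto_const D g.tendsto) simp
  moreover have "(\<lambda>n. m + inverse (real (Suc n))) \<longlonglongrightarrow> m + 0"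
    by (intro tendsto_intros LIMSEQ_inverse_real_of_nat)
  ultimately have "J D \<le> m + 0"
    by (rule LIMSEQ_le) (use x less_imp_le in blast)
  then have JD: "J D \<le> m" by simp
  have "g h = inner h D" for h
  proof -
    define c where "c = inner D h - g h"
    have ineq: "0 \<le> t * c + t\<^sup>2 * inner h h / 2" for t
    proof -
      have "J D \<le> J (D + t *\<^sub>R h)" using JD m_le order_trans by blast
      then show ?thesis unfolding J_def c_def
        by (simp add: g.add g.scaleR inner_add_left inner_add_right inner_commute
            power2_eq_square field_simps)
    qed
    define q where "q = 1 + inner h h"
    have q: "q > 0" "inner h h = q - 1" unfolding q_def using inner_ge_zero[of h] by linarith+
    have "0 \<le> q\<^sup>2 * ((- c / q) * c + (- c / q)\<^sup>2 * inner h h / 2)"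
      using ineq[of "- c / q"] by (intro mult_nonneg_nonneg) auto
    also have "\<dots> = - (c\<^sup>2 * (q + 1)) / 2"
      unfolding q(2) using q(1) by (simp add: power2_eq_square field_simps)
    finally have "c\<^sup>2 * (q + 1) \<le> 0" by simp
    then have "c = 0" using q by (simp add: mult_le_0_iff)
    then show ?thesis unfolding c_def by (simp add: inner_commute)
  qed
  then show ?thesis by blast
qed

lemma GDERIV_gradient:
  fixes f :: "'h::{real_inner, complete_space} \<Rightarrow> real"
  assumes "f differentiable (at x)"
  shows "GDERIV f x :> gradient f x"
proof -
  obtain f' where f': "(f has_derivative f') (at x)"
    using assms unfolding differentiable_def by blast
  obtain D where "\<And>h. f' h = inner h D"
    using riesz_representation[OF has_derivative_bounded_linear[OF f']] by blast
  then have D: "GDERIV f x :> D"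
    using f' unfolding gderiv_def by (metis ext)
  have "E = D" if "GDERIV f x :> E" for E
  proof -
    have "(\<lambda>h. inner h E) = (\<lambda>h. inner h D)"
      using that D unfolding gderiv_def by (rule has_derivative_unique)
    then have "inner (E - D) E = inner (E - D) D" by meson
    then have "inner (E - D) (E - D) = 0" by (simp add: inner_diff_right)
    then show ?thesis by simp
  qed
  then show ?thesis unfolding gradient_def using D by (rule theI[rotated])
qed

lemma has_derivative_hessian:
  assumes "gradient f differentiable (at x)"
  shows "(gradient f has_derivative blinfun_apply (hessian f x)) (at x)"
proof -
  have *: "(gradient f has_derivative frechet_derivative (gradient f) (at x)) (at x)"
    using assms by (simp add: frechet_derivative_works)
  then show ?thesis
    unfolding hessian_def by (simp add: bounded_linear_Blinfun_apply has_derivative_bounded_linear)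
qed

section \<open>Random variables and conditional expectations in a Hilbert space\<close>

text \<open>
  The Bochner integral of the library requires a second countable range. In a possibly
  non-separable space, random variables are the strongly measurable functions; in the
  separable case these are the Borel measurable ones.
\<close>

definition strongly_measurable :: "'w measure \<Rightarrow> ('w \<Rightarrow> 'h::metric_space) \<Rightarrow> bool" where
  "strongly_measurable M X \<longleftrightarrow>
     (\<exists>s. (\<forall>i. simple_function M (s i)) \<and> (\<forall>\<omega>\<in>space M. (\<lambda>i::nat. s i \<omega>) \<longlonglongrightarrow> X \<omega>))"

lemma strongly_measurable_iff_borel_measurable:
  fixes X :: "'w \<Rightarrow> 'h::{metric_space, second_countable_topology}"
  shows "strongly_measurable M X \<longleftrightarrow> X \<in> borel_measurable M"
proof
  assume "strongly_measurable M X"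
  then obtain s where s: "\<And>i::nat. simple_function M (s i)"
      "\<And>\<omega>. \<omega> \<in> space M \<Longrightarrow> (\<lambda>i. s i \<omega>) \<longlonglongrightarrow> X \<omega>"
    unfolding strongly_measurable_def by blast
  show "X \<in> borel_measurable M"
    by (rule borel_measurable_LIMSEQ_metric[of s]) (use s in \<open>auto intro: borel_measurable_simple_function\<close>)
next
  assume X: "X \<in> borel_measurable M"
  show "strongly_measurable M X"
    using borel_measurable_implies_sequence_metric[OF X, of undefined]
    unfolding strongly_measurable_def by blast
qed

text \<open>
  \<open>is_cond_exp M F X Y\<close>: the Hilbert-space-valued integrable random variable \<open>X\<close> has conditional
  expectation \<open>Y\<close> given the sub-sigma-algebra \<open>F\<close>. Vector-valued (conditional) expectations
  are determined by their inner products with fixed vectors.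
\<close>

definition is_cond_exp ::
  "'w measure \<Rightarrow> 'w measure \<Rightarrow> ('w \<Rightarrow> 'h::{real_inner, complete_space}) \<Rightarrow> ('w \<Rightarrow> 'h) \<Rightarrow> bool" where
  "is_cond_exp M F X Y \<longleftrightarrow>
     strongly_measurable M X \<and> integrable M (\<lambda>\<omega>. norm (X \<omega>)) \<and>
     strongly_measurable F Y \<and>
     (\<forall>h. AE \<omega> in M. real_cond_exp M F (\<lambda>\<omega>. inner h (X \<omega>)) \<omega> = inner h (Y \<omega>))"

end

theory Submission
  imports Defs
begin

text \<open>
  Write \<open>H\<close> for the Hessian at \<open>\<theta>opt\<close>, \<open>v k = \<theta> k - \<theta>opt\<close>, and call
  \<open>inner (gradient f (\<theta>opt + x)) x\<close> the gap at \<open>x\<close>; by convexity it dominates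
  \<open>f (\<theta>opt + x) - f \<theta>opt\<close>. The proof transfers information on averages of gradients and of
  gaps, which the recursion supplies, to the averaged point.

  For a quadratic \<open>f\<close> the transfer is immediate, because the average of the gradients is then \<open>H\<close>
  applied to the average of the \<open>v k\<close>. In general the gradient deviates from its linearization at
  \<open>\<theta>opt\<close>, and the heart of the argument is lemma \<open>gradient_deviation\<close>: tested against a vector
  \<open>z\<close>, this deviation at \<open>x\<close> is at most \<open>10 * (R / sqrt \<mu>) * hnorm z\<close> times the gap at \<open>x\<close>,
  where \<open>hnorm\<close> is the norm given by \<open>H\<close>. The self-concordance hypothesis bounds third
  derivatives in a direction repeated three times, and at a single point such a bound does not
  control mixed third derivatives relative to the Hessian with a constant independent of \<open>\<mu>\<close>.
  The deviation is therefore estimated from values of \<open>f\<close> on lines. If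
  \<open>hnorm x\<close> is at most \<open>sqrt \<mu> / (2 * R)\<close>, then
  \<open>f (\<theta>opt + x + z) - f (\<theta>opt + x - z)\<close> is expanded twice, along the two rays from \<open>\<theta>opt\<close> and
  along the line through \<open>\<theta>opt + x\<close>. If \<open>hnorm x\<close> is larger, then the gap is so large that
  it dominates the gradient and its linearization separately. Averaging the lemma with \<open>z\<close>
  equal to the averaged point gives \<open>average_bounds\<close>: up to the factors \<open>1 / \<mu>\<^sup>2\<close> and
  \<open>3 / (2 * \<mu>)\<close> both quantities of the theorem are bounded by the square of
  \<open>p + 10 * R * a\<close>, where \<open>p\<close> is the norm of the average gradient and \<open>a\<close> the average gap.

  It remains to see that \<open>p\<close> and \<open>a\<close> are of order \<open>1 / sqrt N\<close> in mean square. Summing the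
  recursion expresses the average gradient by \<open>v 0 - v N\<close> and by the sum of the noise vectors,
  which are orthogonal in mean square. The gaps enter through the potential
  \<open>(norm (v n))\<^sup>2 + 2 * \<gamma> * (\<Sum>k<n. gap (v k))\<close>, which grows in one step by at most
  \<open>\<gamma>\<^sup>2 * R\<^sup>2\<close> and a centered term whose square is at most a multiple of the potential;
  its second moment obeys a linear recursion. The step size makes the resulting polynomial in
  \<open>R * norm (\<theta>\<^sub>0 - \<theta>opt)\<close> independent of \<open>N\<close>.

  Two points of measure theory need care. The gradients of the random functions are bounded almost
  surely at each fixed point, with an exceptional set depending on the point, whereas the recursion
  evaluates them at random points. Fubini's theorem along segments turns the hypothesis into a
  Lipschitz estimate for countably many pairs of points, and this passes to the random points by
  continuity (\<open>AE_norm_gradient_le\<close>). Moreover the iterates have to be strongly measurable with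
  respect to the filtration; this follows from weak measurability of the gradients by Pettis'
  argument (\<open>strongly_measurable_if_weakly_measurable\<close>).
\<close>

section \<open>Functions of one real variable\<close>

text \<open>The restriction of a self-concordant function to a line, with its three derivatives. By the
  bound on \<open>\<phi>3\<close> the relative rate of change of \<open>\<phi>2\<close> is at most \<open>c\<close>, so that \<open>\<phi>2\<close> stays
  between two exponentials.\<close>

locale self_concordant_line =
  fixes \<phi> \<phi>1 \<phi>2 \<phi>3 :: "real \<Rightarrow> real" and c :: real
  assumes d1: "\<And>t. (\<phi> has_real_derivative \<phi>1 t) (at t)"
    and d2: "\<And>t. (\<phi>1 has_real_derivative \<phi>2 t) (at t)"
    and d3: "\<And>t. (\<phi>2 has_real_derivative \<phi>3 t) (at t)"
    and bound: "\<And>t. \<bar>\<phi>3 t\<bar> \<le> c * \<phi>2 t"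
    and c0: "0 \<le> c" and pos: "\<And>t. 0 \<le> \<phi>2 t"
begin

lemma second_derivative_lower:
  assumes "0 \<le> t" shows "\<phi>2 0 * exp (- c * t) \<le> \<phi>2 t"
proof -
  have "\<phi>2 0 * exp (c * 0) \<le> \<phi>2 t * exp (c * t)"
  proof (rule DERIV_nonneg_imp_nondecreasing[OF assms])
    fix x
    have "((\<lambda>t. \<phi>2 t * exp (c * t)) has_real_derivative (\<phi>3 x + c * \<phi>2 x) * exp (c * x)) (at x)"
      by (auto intro!: derivative_eq_intros d3 simp: algebra_simps)
    moreover have "0 \<le> (\<phi>3 x + c * \<phi>2 x) * exp (c * x)"
      using bound[of x] by (intro mult_nonneg_nonneg) (auto simp: abs_le_iff)
    ultimately show "\<exists>y. ((\<lambda>t. \<phi>2 t * exp (c * t)) has_real_derivative y) (at x) \<and> 0 \<le> y"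
      by blast
  qed
  then show ?thesis by (simp add: exp_minus field_simps)
qed

lemma second_derivative_upper:
  assumes "0 \<le> t" shows "\<phi>2 t \<le> \<phi>2 0 * exp (c * t)"
proof -
  have "\<phi>2 t * exp (- c * t) \<le> \<phi>2 0 * exp (- c * 0)"
  proof (rule DERIV_nonpos_imp_nonincreasing[OF assms])
    fix x
    have "((\<lambda>t. \<phi>2 t * exp (- c * t)) has_real_derivative (\<phi>3 x - c * \<phi>2 x) * exp (- c * x)) (at x)"
      by (auto intro!: derivative_eq_intros d3 simp: algebra_simps)
    moreover have "(\<phi>3 x - c * \<phi>2 x) * exp (- c * x) \<le> 0"
      using bound[of x] by (intro mult_nonpos_nonneg) (auto simp: abs_le_iff)
    ultimately show "\<exists>y. ((\<lambda>t. \<phi>2 t * exp (- c * t)) has_real_derivative y) (at x) \<and> y \<le> 0"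
      by blast
  qed
  then show ?thesis by (simp add: exp_minus field_simps)
qed

lemma second_order_Taylor:
  "exp (- c) / 2 * \<phi>2 0 \<le> \<phi> 1 - \<phi> 0 - \<phi>1 0"
  "\<phi> 1 - \<phi> 0 - \<phi>1 0 \<le> exp c / 2 * \<phi>2 0"
proof -
  obtain t where t: "0 < t" "t < 1" and eq: "\<phi> 1 = (\<Sum>m<2. ([\<phi>, \<phi>1, \<phi>2] ! m) 0 / fact m * 1 ^ m) + ([\<phi>, \<phi>1, \<phi>2] ! 2) t / fact 2 * 1 ^ 2"
  proof -
    have "\<forall>m t. m < 2 \<and> 0 \<le> t \<and> t \<le> 1 \<longrightarrow>
        DERIV (([\<phi>, \<phi>1, \<phi>2]) ! m) t :> ([\<phi>, \<phi>1, \<phi>2] ! Suc m) t"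
      using d1 d2 by (auto simp: less_2_cases_iff)
    then show ?thesis
      using Maclaurin[of 1 2 "\<lambda>m. [\<phi>, \<phi>1, \<phi>2] ! m" \<phi>] that by auto
  qed
  have e: "\<phi> 1 - \<phi> 0 - \<phi>1 0 = \<phi>2 t / 2"
    using eq by (simp add: numeral_2_eq_2)
  have "\<phi>2 0 * exp (- c) \<le> \<phi>2 0 * exp (- c * t)" "\<phi>2 0 * exp (c * t) \<le> \<phi>2 0 * exp c"
    using t c0 pos by (auto intro!: mult_left_mono mult_left_le)
  then show "exp (- c) / 2 * \<phi>2 0 \<le> \<phi> 1 - \<phi> 0 - \<phi>1 0"
    "\<phi> 1 - \<phi> 0 - \<phi>1 0 \<le> exp c / 2 * \<phi>2 0"
    using e second_derivative_lower[of t] second_derivative_upper[of t] t by (auto simp: mult.commute)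
qed

lemma third_order_Taylor:
  "\<bar>\<phi> 1 - \<phi> 0 - \<phi>1 0 - \<phi>2 0 / 2\<bar> \<le> c * exp c / 6 * \<phi>2 0"
proof -
  obtain t where t: "0 < t" "t < 1" and eq: "\<phi> 1 = (\<Sum>m<3. ([\<phi>, \<phi>1, \<phi>2, \<phi>3] ! m) 0 / fact m * 1 ^ m) + ([\<phi>, \<phi>1, \<phi>2, \<phi>3] ! 3) t / fact 3 * 1 ^ 3"
  proof -
    have "\<forall>m t. m < 3 \<and> 0 \<le> t \<and> t \<le> 1 \<longrightarrow>
        DERIV (([\<phi>, \<phi>1, \<phi>2, \<phi>3]) ! m) t :> ([\<phi>, \<phi>1, \<phi>2, \<phi>3] ! Suc m) t"
      using d1 d2 d3 by (auto simp: less_Suc_eq numeral_3_eq_3)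
    then show ?thesis
      using Maclaurin[of 1 3 "\<lambda>m. [\<phi>, \<phi>1, \<phi>2, \<phi>3] ! m" \<phi>] that by auto
  qed
  have e: "\<phi> 1 - \<phi> 0 - \<phi>1 0 - \<phi>2 0 / 2 = \<phi>3 t / 6"
    using eq by (simp add: numeral_3_eq_3 fact_numeral)
  have "\<bar>\<phi>3 t\<bar> \<le> c * (\<phi>2 0 * exp (c * t))"
    using bound[of t] second_derivative_upper[of t] t c0 by (meson mult_left_mono order_trans less_imp_le)
  also have "\<dots> \<le> c * (\<phi>2 0 * exp c)"
    using t c0 pos by (auto intro!: mult_left_mono mult_left_le)
  finally show ?thesis unfolding e by (simp add: mult_ac)
qed

text \<open>The constraint \<open>c * \<tau> \<le> 1\<close> confines the estimate to the stretch on which the second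
  derivative has not yet decayed; beyond it only the monotonicity of \<open>\<phi>1\<close> is used.\<close>

lemma first_derivative_growth:
  assumes "0 \<le> \<tau>" "\<tau> \<le> 1" "c * \<tau> \<le> 1"
  shows "\<tau> / 2 * \<phi>2 0 \<le> \<phi>1 1 - \<phi>1 0"
proof -
  have "\<phi>1 0 - \<phi>2 0 * (0 - c * 0\<^sup>2 / 2) \<le> \<phi>1 \<tau> - \<phi>2 0 * (\<tau> - c * \<tau>\<^sup>2 / 2)"
  proof (rule DERIV_nonneg_imp_nondecreasing[OF assms(1)])
    fix x :: real assume x: "0 \<le> x"
    have "((\<lambda>t. \<phi>1 t - \<phi>2 0 * (t - c * t\<^sup>2 / 2)) has_real_derivative \<phi>2 x - \<phi>2 0 * (1 - c * x)) (at x)"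
      by (auto intro!: derivative_eq_intros d2)
    moreover have "\<phi>2 0 * (1 - c * x) \<le> \<phi>2 0 * exp (- c * x)"
      using exp_ge_add_one_self[of "- c * x"] pos by (intro mult_left_mono) auto
    then have "0 \<le> \<phi>2 x - \<phi>2 0 * (1 - c * x)"
      using second_derivative_lower[OF x] by linarith
    ultimately show "\<exists>y. ((\<lambda>t. \<phi>1 t - \<phi>2 0 * (t - c * t\<^sup>2 / 2)) has_real_derivative y) (at x) \<and> 0 \<le> y"
      by blast
  qed
  moreover have "\<phi>1 \<tau> \<le> \<phi>1 1"
    using d2 pos by (intro DERIV_nonneg_imp_nondecreasing[OF assms(2)]) blast
  moreover have "\<tau> / 2 * \<phi>2 0 \<le> \<phi>2 0 * (\<tau> - c * \<tau>\<^sup>2 / 2)"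
  proof -
    have "(c * \<tau>) * \<tau> \<le> 1 * \<tau>" by (rule mult_right_mono) (use assms in auto)
    then have "\<tau> / 2 \<le> \<tau> - c * \<tau>\<^sup>2 / 2" by (simp add: power2_eq_square field_simps)
    then show ?thesis using pos[of 0] by (subst mult.commute) (rule mult_left_mono)
  qed
  ultimately show ?thesis by simp
qed

end

section \<open>Generalized self-concordance along lines\<close>

locale generalized_self_concordant =
  fixes f :: "'h::{real_inner, complete_space} \<Rightarrow> real" and R :: real
  assumes smooth: "three_times_differentiable f"
    and R_pos: "0 < R"
    and self_concordant: "\<And>x y t. let \<phi> = (\<lambda>s. f (x + s *\<^sub>R (y - x)))
               in \<bar>(deriv ^^ 3) \<phi> t\<bar> \<le> R * norm (x - y) * (deriv ^^ 2) \<phi> t"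
begin

lemma DERIV_line:
  "((\<lambda>t. f (x + t *\<^sub>R h)) has_real_derivative inner (gradient f (x + t *\<^sub>R h)) h) (at t)"
proof -
  have "(f has_derivative (\<lambda>k. inner k (gradient f (x + t *\<^sub>R h)))) (at (x + t *\<^sub>R h))"
    using GDERIV_gradient smooth unfolding three_times_differentiable_def gderiv_def by blast
  then have "((\<lambda>t. f (x + t *\<^sub>R h)) has_derivative (\<lambda>s. inner (s *\<^sub>R h) (gradient f (x + t *\<^sub>R h)))) (at t)"
    by (rule has_derivative_compose[rotated]) (auto intro!: derivative_eq_intros)
  then show ?thesis
    unfolding has_field_derivative_def by (rule has_derivative_eq_rhs) (auto simp: inner_commute)
qed

lemma DERIV_gradient_line:
  "((\<lambda>t. inner (gradient f (x + t *\<^sub>R h)) h) has_real_derivative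
      inner (hessian f (x + t *\<^sub>R h) h) h) (at t)"
proof -
  have "(gradient f has_derivative hessian f (x + t *\<^sub>R h)) (at (x + t *\<^sub>R h))"
    using has_derivative_hessian smooth unfolding three_times_differentiable_def by blast
  then have "((\<lambda>t. gradient f (x + t *\<^sub>R h)) has_derivative (\<lambda>s. hessian f (x + t *\<^sub>R h) (s *\<^sub>R h))) (at t)"
    by (rule has_derivative_compose[rotated]) (auto intro!: derivative_eq_intros)
  from has_derivative_inner_left[OF this, of h] show ?thesis
    unfolding has_field_derivative_def
    by (rule has_derivative_eq_rhs) (auto simp: blinfun.scaleR_right)
qed

lemma hessian_line_differentiable:
  "(\<lambda>t. inner (hessian f (x + t *\<^sub>R h) h) h) differentiable (at t)"
proof -
  obtain D where "(hessian f has_derivative D) (at (x + t *\<^sub>R h))"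
    using smooth unfolding three_times_differentiable_def differentiable_def by blast
  then have "((\<lambda>t. hessian f (x + t *\<^sub>R h)) has_derivative (\<lambda>s. D (s *\<^sub>R h))) (at t)"
    by (rule has_derivative_compose[rotated]) (auto intro!: derivative_eq_intros)
  then have "((\<lambda>t. inner (hessian f (x + t *\<^sub>R h) h) h) has_derivative (\<lambda>s. inner (D (s *\<^sub>R h) h) h)) (at t)"
    by (auto intro!: derivative_eq_intros)
  then show ?thesis unfolding differentiable_def by blast
qed

lemma line:
  "self_concordant_line (\<lambda>t. f (x + t *\<^sub>R h)) (\<lambda>t. inner (gradient f (x + t *\<^sub>R h)) h)
     (\<lambda>t. inner (hessian f (x + t *\<^sub>R h) h) h)
     (deriv (\<lambda>t. inner (hessian f (x + t *\<^sub>R h) h) h)) (R * norm h)"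
proof -
  let ?\<phi> = "\<lambda>t. f (x + t *\<^sub>R h)"
  let ?\<phi>2 = "\<lambda>t. inner (hessian f (x + t *\<^sub>R h) h) h"
  have d: "deriv ?\<phi> = (\<lambda>t. inner (gradient f (x + t *\<^sub>R h)) h)"
    by (rule ext, rule DERIV_imp_deriv, rule DERIV_line)
  have d': "deriv (\<lambda>t. inner (gradient f (x + t *\<^sub>R h)) h) = ?\<phi>2"
    by (rule ext, rule DERIV_imp_deriv, rule DERIV_gradient_line)
  have bound: "\<bar>deriv ?\<phi>2 t\<bar> \<le> R * norm h * ?\<phi>2 t" for t
    using self_concordant[of x "x + h" t]
    by (simp add: Let_def numeral_3_eq_3 numeral_2_eq_2 d d' norm_minus_commute)
  \<comment> \<open>A positive multiple of \<open>?\<phi>2 t\<close> dominates an absolute value.\<close>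
  have pos: "0 \<le> ?\<phi>2 t" for t
  proof (cases "h = 0")
    case False
    then have "0 < R * norm h" using R_pos by simp
    then show ?thesis using bound[of t] by (smt (verit) zero_le_mult_iff)
  qed simp
  show ?thesis
  proof
    show "(?\<phi>2 has_real_derivative deriv ?\<phi>2 t) (at t)" for t
      using hessian_line_differentiable by (simp add: DERIV_deriv_iff_real_differentiable)
  qed (use bound pos R_pos DERIV_line DERIV_gradient_line in auto)
qed

definition curvature :: "'h \<Rightarrow> 'h \<Rightarrow> real" where
  "curvature x h = inner (hessian f x h) h"

lemma curvature_nonneg: "0 \<le> curvature x h"
  using self_concordant_line.pos[OF line, of x 0 h] by (simp add: curvature_def)

lemma curvature_scaleR: "curvature x (c *\<^sub>R h) = c\<^sup>2 * curvature x h"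
  by (simp add: curvature_def blinfun.scaleR_right power2_eq_square)

lemma curvature_minus [simp]: "curvature x (- h) = curvature x h"
  by (simp add: curvature_def blinfun.minus_right)

lemma second_order_lower:
  "exp (- (R * norm h)) / 2 * curvature x h \<le> f (x + h) - f x - inner (gradient f x) h"
  using self_concordant_line.second_order_Taylor(1)[OF line, of h x] by (simp add: curvature_def)

lemma second_order_upper:
  "f (x + h) - f x - inner (gradient f x) h \<le> exp (R * norm h) / 2 * curvature x h"
  using self_concordant_line.second_order_Taylor(2)[OF line, of x h] by (simp add: curvature_def)

lemma third_order_expansion:
  "\<bar>f (x + h) - f x - inner (gradient f x) h - curvature x h / 2\<bar>
     \<le> R * norm h * exp (R * norm h) / 6 * curvature x h"
  using self_concordant_line.third_order_Taylor[OF line, of x h] by (simp add: curvature_def)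

lemma gradient_growth:
  assumes "0 \<le> \<tau>" "\<tau> \<le> 1" "R * norm h * \<tau> \<le> 1"
  shows "\<tau> / 2 * curvature x h \<le> inner (gradient f (x + h) - gradient f x) h"
  using self_concordant_line.first_derivative_growth[OF line assms, of x]
  by (simp add: curvature_def inner_diff_left)

lemma gradient_inequality: "f x + inner (gradient f x) h \<le> f (x + h)"
proof -
  have "0 \<le> exp (- (R * norm h)) / 2 * curvature x h"
    using curvature_nonneg by simp
  then show ?thesis using second_order_lower[of h x] by linarith
qed

end

section \<open>Deviation of the gradient from its linearization\<close>

locale self_concordant_minimum = generalized_self_concordant +
  fixes xs :: 'a and \<mu> :: real
  assumes minimum: "\<And>x. f xs \<le> f x"
    and \<mu>_pos: "0 < \<mu>"
    and \<mu>_le: "\<And>h. \<mu> * (norm h)\<^sup>2 \<le> curvature xs h"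
begin

lemma gradient_minimum: "gradient f xs = 0"
proof -
  have "(\<lambda>k. inner k (gradient f xs)) = (\<lambda>k. 0)"
  proof (rule differential_zero_maxmin[of xs UNIV])
    show "(f has_derivative (\<lambda>k. inner k (gradient f xs))) (at xs)"
      using GDERIV_gradient smooth unfolding three_times_differentiable_def gderiv_def by blast
  qed (use minimum in auto)
  then have "inner (gradient f xs) (gradient f xs) = 0" by meson
  then show ?thesis by simp
qed

text \<open>The polar form of the curvature at the minimizer, symmetrized so that the curvatures of
  \<open>x + z\<close> and \<open>x - z\<close> differ by \<open>4 * polar x z\<close>.\<close>

definition polar :: "'a \<Rightarrow> 'a \<Rightarrow> real" where
  "polar x z = (inner (hessian f xs x) z + inner (hessian f xs z) x) / 2"

definition hnorm :: "'a \<Rightarrow> real" where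
  "hnorm x = sqrt (curvature xs x)"

definition gap :: "'a \<Rightarrow> real" where
  "gap x = inner (gradient f (xs + x)) x"

lemma hnorm_square: "(hnorm x)\<^sup>2 = curvature xs x"
  by (simp add: hnorm_def curvature_nonneg)

lemma hnorm_nonneg [simp]: "0 \<le> hnorm x"
  by (simp add: hnorm_def curvature_nonneg)

lemma hnorm_scaleR: "hnorm (c *\<^sub>R x) = \<bar>c\<bar> * hnorm x"
  by (simp add: hnorm_def curvature_scaleR real_sqrt_mult)

lemma norm_le_hnorm: "sqrt \<mu> * norm x \<le> hnorm x"
  using \<mu>_le[of x] unfolding hnorm_def by (metis norm_ge_zero real_sqrt_abs real_sqrt_le_mono real_sqrt_mult abs_of_nonneg)

lemma hnorm_pos: "x \<noteq> 0 \<Longrightarrow> 0 < hnorm x"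
  using norm_le_hnorm[of x] \<mu>_pos by (smt (verit) mult_pos_pos real_sqrt_gt_zero zero_less_norm_iff)

lemma hnorm_zero [simp]: "hnorm 0 = 0"
  by (simp add: hnorm_def curvature_def)

lemma curvature_add: "curvature xs (x + z) = curvature xs x + 2 * polar x z + curvature xs z"
  by (simp add: curvature_def polar_def blinfun.add_right inner_add_left inner_add_right)

lemma curvature_diff: "curvature xs (x - z) = curvature xs x - 2 * polar x z + curvature xs z"
  by (simp add: curvature_def polar_def blinfun.diff_right inner_diff_left inner_diff_right field_simps)

lemma polar_self: "polar x x = (hnorm x)\<^sup>2"
  by (simp add: hnorm_square polar_def curvature_def)

lemma polar_scaleR_left: "polar (c *\<^sub>R x) z = c * polar x z"
  by (simp add: polar_def blinfun.scaleR_right algebra_simps)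

lemma polar_scaleR_right: "polar x (c *\<^sub>R z) = c * polar x z"
  by (simp add: polar_def blinfun.scaleR_right algebra_simps)

lemma polar_sum_left: "polar (sum x A) z = (\<Sum>k\<in>A. polar (x k) z)"
  by (simp add: polar_def blinfun.sum_right inner_sum_left inner_sum_right sum.distrib flip: sum_divide_distrib)

lemma polar_Cauchy_Schwarz: "\<bar>polar x z\<bar> \<le> hnorm x * hnorm z"
proof (cases "z = 0")
  case False
  then have q: "0 < curvature xs z" using hnorm_pos[of z] by (simp add: hnorm_square[symmetric])
  define t where "t = - polar x z / curvature xs z"
  have "0 \<le> curvature xs (x + t *\<^sub>R z)" by (rule curvature_nonneg)
  also have "\<dots> = curvature xs x - (polar x z)\<^sup>2 / curvature xs z"
    unfolding curvature_add polar_scaleR_right curvature_scaleR t_def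
    using q by (simp add: power2_eq_square field_simps)
  finally have "(polar x z)\<^sup>2 \<le> (hnorm x * hnorm z)\<^sup>2"
    using q by (simp add: power_mult_distrib hnorm_square field_simps)
  then show ?thesis by (metis abs_le_square_iff abs_of_nonneg hnorm_nonneg mult_nonneg_nonneg)
qed (simp add: polar_def)

lemma value_le_gap: "f (xs + x) - f xs \<le> gap x"
  using gradient_inequality[of "xs + x" "- x"] by (simp add: gap_def)

lemma gap_nonneg: "0 \<le> gap x"
  using value_le_gap[of x] minimum[of "xs + x"] by linarith

text \<open>The gap is an increment of the slope along the ray from the minimizer to \<open>xs + x\<close>, where the
  slope starts at zero.\<close>

lemma gap_lower:
  assumes "0 \<le> \<tau>" "\<tau> \<le> 1" "R * norm x * \<tau> \<le> 1"
  shows "\<tau> / 2 * (hnorm x)\<^sup>2 \<le> gap x"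
  using gradient_growth[OF assms, of xs] by (simp add: gap_def gradient_minimum hnorm_square)

lemma R_norm_le: "R * norm x \<le> R / sqrt \<mu> * hnorm x"
proof -
  have "norm x \<le> hnorm x / sqrt \<mu>"
    using norm_le_hnorm[of x] \<mu>_pos by (simp add: field_simps)
  then show ?thesis using R_pos by (metis mult_left_mono less_imp_le times_divide_eq_left times_divide_eq_right)
qed

lemma exp_le_7_4: "c \<le> 1 / 2 \<Longrightarrow> exp c \<le> 7 / (4::real)"
proof -
  assume "c \<le> 1 / 2"
  then have "exp c \<le> exp (1/2)" by simp
  also have "\<dots> \<le> 1 + 1/2 + (1/2)\<^sup>2" by (rule exp_bound) auto
  finally show ?thesis by (simp add: power2_eq_square)
qed

text \<open>With \<open>hnorm z = hnorm x\<close> the difference \<open>f (xs + (x + z)) - f (xs + (x - z))\<close> has two expansions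
  whose third-order errors are all of the order of the gap at \<open>x\<close> times
  \<open>R / sqrt \<mu> * hnorm x\<close>. On the rays from the minimizer the quadratic terms differ by
  \<open>2 * polar x z\<close>; on the line through \<open>xs + x\<close> in direction \<open>z\<close> they cancel and leave twice
  the derivative. The curvature at \<open>xs + x\<close> in direction \<open>z\<close>, which governs the error on that
  line, is recovered from a second difference of values of \<open>f\<close>, and
  these values are again controlled by the rays.\<close>

lemma near_deviation:
  assumes \<kappa>: "R / sqrt \<mu> * hnorm x \<le> 1 / 2" and eq: "hnorm z = hnorm x"
  shows "\<bar>inner (gradient f (xs + x)) z - polar x z\<bar> \<le> 10 * (R / sqrt \<mu>) * hnorm z * gap x"
proof -
  define \<kappa> where "\<kappa> = R / sqrt \<mu> * hnorm x"
  define \<rho> where "\<rho> = hnorm x"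
  have \<kappa>0: "0 \<le> \<kappa>" "\<kappa> \<le> 1 / 2" using assms R_pos \<mu>_pos by (auto simp: \<kappa>_def)
  have cx: "R * norm x \<le> \<kappa>" and cz: "R * norm z \<le> \<kappa>"
    using R_norm_le[of x] R_norm_le[of z] eq by (auto simp: \<kappa>_def)
  have ex: "exp \<kappa> \<le> 7/4" by (rule exp_le_7_4) fact
  have "exp (2 * \<kappa>) \<le> exp 1" using \<kappa>0 by simp
  also have "exp 1 \<le> (11/4::real)" using e_less_272 by simp
  finally have ex2: "exp (2 * \<kappa>) \<le> (11 / 4)" .
  have Qx: "curvature xs x = \<rho>\<^sup>2" and Qz: "curvature xs z = \<rho>\<^sup>2"
    using eq by (auto simp: \<rho>_def hnorm_square[symmetric])
  \<comment> \<open>The rays to \<open>x + z\<close> and \<open>x - z\<close> have length up to twice that of \<open>x\<close> and \<open>z\<close>; the bound \<open>11 / 4\<close> exceeds \<open>exp 1\<close>.\<close>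
  have ray: "\<bar>f (xs + w) - f xs - curvature xs w / 2\<bar> \<le> 2 * \<kappa> * (11 / 4) / 6 * curvature xs w"
    and ray': "f (xs + w) - f xs \<le> (11 / 4) / 2 * curvature xs w"
    if "R * norm w \<le> 2 * \<kappa>" for w
  proof -
    have ew: "exp (R * norm w) \<le> (11 / 4)" using that ex2 by (meson exp_le_cancel_iff order_trans)
    have "R * norm w * exp (R * norm w) \<le> 2 * \<kappa> * (11 / 4)"
      by (rule mult_mono) (use that ew \<kappa>0 R_pos in auto)
    then have "R * norm w * exp (R * norm w) / 6 * curvature xs w \<le> 2 * \<kappa> * (11 / 4) / 6 * curvature xs w"
      by (intro mult_right_mono divide_right_mono curvature_nonneg) auto
    then show "\<bar>f (xs + w) - f xs - curvature xs w / 2\<bar> \<le> 2 * \<kappa> * (11 / 4) / 6 * curvature xs w"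
      using third_order_expansion[of xs w] unfolding gradient_minimum inner_zero_left by linarith
    have "exp (R * norm w) / 2 * curvature xs w \<le> (11 / 4) / 2 * curvature xs w"
      using ew by (intro mult_right_mono curvature_nonneg) auto
    then show "f (xs + w) - f xs \<le> (11 / 4) / 2 * curvature xs w"
      using second_order_upper[of xs w] unfolding gradient_minimum inner_zero_left by linarith
  qed
  have cw: "R * norm (x + z) \<le> 2 * \<kappa>" "R * norm (x - z) \<le> 2 * \<kappa>"
    using cx cz R_pos norm_triangle_ineq[of x z] norm_triangle_ineq4[of x z]
    by (smt (verit) distrib_left mult_left_mono)+
  have par: "curvature xs (x + z) + curvature xs (x - z) = 4 * \<rho>\<^sup>2"
    "curvature xs (x + z) - curvature xs (x - z) = 4 * polar x z"
    by (simp_all add: curvature_add curvature_diff Qx Qz)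
  have odd_rays: "\<bar>f (xs + (x + z)) - f (xs + (x - z)) - 2 * polar x z\<bar> \<le> 4 * (\<kappa> * \<rho>\<^sup>2)"
  proof -
    have "2 * \<kappa> * (11 / 4) / 6 * curvature xs (x + z) + 2 * \<kappa> * (11 / 4) / 6 * curvature xs (x - z)
       = 2 * \<kappa> * (11 / 4) / 6 * (4 * \<rho>\<^sup>2)" using par(1) by (metis distrib_left)
    also have "\<dots> \<le> 4 * (\<kappa> * \<rho>\<^sup>2)" using \<kappa>0 by simp
    finally show ?thesis using ray[OF cw(1)] ray[OF cw(2)] par(2) by linarith
  qed
  define q where "q = curvature (xs + x) z"
  have q_le: "q \<le> 10 * \<rho>\<^sup>2"
  proof -
    have "4/7 \<le> exp (- (R * norm z))"
    proof -
      have "exp (R * norm z) \<le> 7/4" using cz ex by (meson exp_le_cancel_iff order_trans)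
      then have "1 / (7/4) \<le> 1 / exp (R * norm z)" by (intro divide_left_mono) auto
      then show ?thesis by (simp add: exp_minus inverse_eq_divide)
    qed
    then have "4/7 / 2 * q \<le> exp (- (R * norm z)) / 2 * q"
      unfolding q_def by (intro mult_right_mono divide_right_mono curvature_nonneg) auto
    then have "4/7 * q \<le> f (xs + x + z) + f (xs + x - z) - 2 * f (xs + x)"
      using second_order_lower[of z "xs + x"] second_order_lower[of "-z" "xs + x"]
      by (simp add: q_def)
    also have "\<dots> \<le> (11 / 4) / 2 * (curvature xs (x + z) + curvature xs (x - z))"
      using ray'[OF cw(1)] ray'[OF cw(2)] minimum[of "xs + x"] by (simp add: add.assoc add_diff_eq distrib_left)
    finally show ?thesis unfolding par using zero_le_power2[of \<rho>] by linarith
  qed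
  have odd_line: "\<bar>f (xs + (x + z)) - f (xs + (x - z)) - 2 * inner (gradient f (xs + x)) z\<bar> \<le> 6 * (\<kappa> * \<rho>\<^sup>2)"
  proof -
    have "R * norm z * exp (R * norm z) \<le> \<kappa> * (7/4)"
    proof (rule mult_mono)
      show "exp (R * norm z) \<le> 7/4" using cz ex by (meson exp_le_cancel_iff order_trans)
    qed (use cz \<kappa>0 R_pos in auto)
    then have "R * norm z * exp (R * norm z) / 6 * q \<le> \<kappa> * (7/4) / 6 * (10 * \<rho>\<^sup>2)"
      by (rule mult_mono[OF divide_right_mono]) (use \<kappa>0 q_le in \<open>auto simp: q_def curvature_nonneg\<close>)
    also have "\<dots> \<le> 3 * (\<kappa> * \<rho>\<^sup>2)" using \<kappa>0 by simp
    finally show ?thesis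
      using third_order_expansion[of "xs + x" z] third_order_expansion[of "xs + x" "-z"]
      unfolding norm_minus_cancel inner_minus_right curvature_minus q_def[symmetric]
        add.assoc add_uminus_conv_diff add_diff_eq by linarith
  qed
  have "\<bar>inner (gradient f (xs + x)) z - polar x z\<bar> \<le> 10 * \<kappa> * (\<rho>\<^sup>2 / 2)"
  proof -
    have "0 \<le> \<kappa> * \<rho>\<^sup>2" using \<kappa>0 by simp
    then have "\<bar>inner (gradient f (xs + x)) z - polar x z\<bar> \<le> 5 * (\<kappa> * \<rho>\<^sup>2)"
      using odd_rays odd_line by linarith
    then show ?thesis by simp
  qed
  also have "\<dots> \<le> 10 * \<kappa> * gap x"
    using gap_lower[of 1 x] cx \<kappa>0 by (intro mult_left_mono) (auto simp: \<rho>_def)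
  finally show ?thesis by (simp add: \<kappa>_def eq mult_ac)
qed

text \<open>Far from the minimizer the gap is at least a multiple of \<open>\<mu> / R\<^sup>2\<close> and of
  \<open>sqrt \<mu> / R * hnorm x\<close>. The second bound absorbs the linear part by the Cauchy-Schwarz
  inequality. For the gradient, the tangent inequality at \<open>xs + x\<close>, evaluated at \<open>xs + w\<close>, gives
  \<open>inner (gradient f (xs + x)) w \<le> f (xs + w) - f (xs + x) + gap x\<close>; a vector \<open>w\<close> with
  \<open>hnorm w = sqrt \<mu> / (2 * R)\<close> is short enough for \<open>f (xs + w) - f xs\<close> to be of order
  \<open>\<mu> / R\<^sup>2\<close>, hence at most a multiple of the gap.\<close>

lemma far_deviation:
  assumes \<kappa>: "1 / 2 \<le> R / sqrt \<mu> * hnorm x" and eq: "hnorm z = sqrt \<mu> / (2 * R)"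
  shows "\<bar>inner (gradient f (xs + x)) z - polar x z\<bar> \<le> 10 * (R / sqrt \<mu>) * hnorm z * gap x"
proof -
  define s where "s = sqrt \<mu>"
  define \<rho> where "\<rho> = hnorm x"
  have s: "0 < s" using \<mu>_pos by (simp add: s_def)
  have \<rho>: "s / (2 * R) \<le> \<rho>" using \<kappa> s R_pos by (simp add: s_def \<rho>_def field_simps)
  then have \<rho>0: "0 < \<rho>" using s R_pos by (smt (verit) divide_pos_pos)
  have gap1: "\<rho> * (s / (4 * R)) \<le> gap x"
  proof (cases "R * norm x \<le> 1")
    case True
    then have "1 / 2 * \<rho>\<^sup>2 \<le> gap x" using gap_lower[of 1 x] by (simp add: \<rho>_def)
    moreover have "\<rho> * (s / (2 * R)) \<le> \<rho> * \<rho>" using \<rho> \<rho>0 by (intro mult_left_mono) auto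
    ultimately show ?thesis by (simp add: power2_eq_square)
  next
    case False
    then have "1 / (R * norm x) / 2 * \<rho>\<^sup>2 \<le> gap x" using gap_lower[of "1 / (R * norm x)" x] by (simp add: \<rho>_def)
    moreover have "s / R * \<rho> \<le> 1 / (R * norm x) * \<rho>\<^sup>2"
    proof -
      have "norm x * s \<le> \<rho>" using norm_le_hnorm[of x] by (simp add: s_def \<rho>_def mult.commute)
      then have "norm x * s * \<rho> \<le> \<rho> * \<rho>" using \<rho>0 by (intro mult_right_mono) auto
      moreover have "0 < norm x" using False by force
      ultimately show ?thesis using R_pos by (simp add: field_simps power2_eq_square)
    qed
    moreover have "0 \<le> s / R * \<rho>" using s R_pos \<rho>0 by simp
    ultimately show ?thesis by (simp add: field_simps)
  qed
  have gap2: "s\<^sup>2 / (8 * R\<^sup>2) \<le> gap x"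
  proof -
    have "s / (2 * R) * (s / (4 * R)) \<le> \<rho> * (s / (4 * R))"
      using \<rho> s R_pos by (intro mult_right_mono) auto
    then show ?thesis using gap1 by (simp add: power2_eq_square)
  qed
  have pol: "\<bar>polar x z\<bar> \<le> 2 * gap x"
  proof -
    have "\<bar>polar x z\<bar> \<le> \<rho> * (s / (2 * R))" using polar_Cauchy_Schwarz[of x z] eq by (simp add: \<rho>_def s_def)
    then show ?thesis using gap1 by simp
  qed
  have cz: "R * norm z \<le> 1 / 2"
    using R_norm_le[of z] eq R_pos \<mu>_pos by simp
  have one_sided: "inner (gradient f (xs + x)) w \<le> 11 / 4 * gap x"
    if w: "curvature xs w = curvature xs z" "norm w = norm z" for w
  proof -
    have "exp (R * norm w) / 2 * curvature xs w \<le> 7 / 4 / 2 * curvature xs w"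
      using exp_le_7_4[OF cz] w by (intro mult_right_mono divide_right_mono curvature_nonneg) auto
    also have "\<dots> = 7 / 4 * (s\<^sup>2 / (8 * R\<^sup>2))"
      unfolding w(1) unfolding hnorm_square[symmetric] eq by (simp add: s_def power_divide power_mult_distrib)
    finally have "f (xs + w) - f xs \<le> 7 / 4 * gap x"
      using second_order_upper[of xs w] gap2 by (simp add: gradient_minimum)
    then show ?thesis
      using gradient_inequality[of "xs + x" "w - x"] minimum[of "xs + x"]
      by (simp add: gap_def inner_diff_right)
  qed
  have "\<bar>inner (gradient f (xs + x)) z\<bar> \<le> 11 / 4 * gap x"
    using one_sided[of z] one_sided[of "-z"] by simp
  then have "\<bar>inner (gradient f (xs + x)) z - polar x z\<bar> \<le> 5 * gap x"
    using pol gap_nonneg[of x] by linarith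
  also have "\<dots> = 10 * (R / sqrt \<mu>) * hnorm z * gap x"
    unfolding eq using R_pos \<mu>_pos by (simp add: field_simps)
  finally show ?thesis .
qed

text \<open>Both sides are homogeneous in \<open>z\<close>, so it suffices to treat one value of \<open>hnorm z\<close> for each \<open>x\<close>.\<close>

lemma gradient_deviation:
  "\<bar>inner (gradient f (xs + x)) z - polar x z\<bar> \<le> 10 * (R / sqrt \<mu>) * hnorm z * gap x"
proof -
  have reduce: ?thesis
    if a: "0 < a" and
      dev: "\<And>w. hnorm w = a \<Longrightarrow> \<bar>inner (gradient f (xs + x)) w - polar x w\<bar> \<le> 10 * (R / sqrt \<mu>) * hnorm w * gap x"
    for a
  proof (cases "z = 0")
    case False
    define c where "c = a / hnorm z"
    have c: "0 < c" using a hnorm_pos[OF False] by (simp add: c_def)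
    have "hnorm (c *\<^sub>R z) = a"
      using c a hnorm_pos[OF False] by (simp add: hnorm_scaleR c_def)
    from dev[OF this]
    have "\<bar>c * (inner (gradient f (xs + x)) z - polar x z)\<bar> \<le> c * (10 * (R / sqrt \<mu>) * hnorm z * gap x)"
      using c by (simp add: polar_scaleR_right hnorm_scaleR right_diff_distrib mult_ac)
    then have "c * \<bar>inner (gradient f (xs + x)) z - polar x z\<bar> \<le> c * (10 * (R / sqrt \<mu>) * hnorm z * gap x)"
      using c by (simp only: abs_mult abs_of_pos)
    then show ?thesis using c by (rule mult_left_le_imp_le)
  qed (simp add: polar_def)
  consider "x = 0" | "x \<noteq> 0" "R / sqrt \<mu> * hnorm x \<le> 1 / 2" | "1 / 2 \<le> R / sqrt \<mu> * hnorm x"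
    by linarith
  then show ?thesis
  proof cases
    case 1
    then show ?thesis by (simp add: gradient_minimum polar_def gap_def)
  next
    case 2
    then show ?thesis using hnorm_pos near_deviation by (intro reduce[of "hnorm x"]) auto
  next
    case 3
    then show ?thesis using R_pos \<mu>_pos far_deviation by (intro reduce[of "sqrt \<mu> / (2 * R)"]) auto
  qed
qed

text \<open>
  Testing the averaged deviation estimate against \<open>y\<close> itself yields \<open>(hnorm y)\<^sup>2\<close> on the left and
  one factor \<open>hnorm y\<close> on the right, which cancels. The bound on the value of \<open>f\<close> follows from the
  second-order expansion when \<open>y\<close> is short; when \<open>R * norm y\<close> exceeds 1, the value is at most
  the average gap \<open>a\<close> by convexity, and the bound on \<open>norm y\<close> supplies the second factor.\<close>

lemma average_bounds:
  fixes v :: "nat \<Rightarrow> 'a" and N :: nat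
  assumes N: "0 < N"
  defines "y \<equiv> (1 / real N) *\<^sub>R (\<Sum>k<N. v k)"
    and "p \<equiv> norm ((1 / real N) *\<^sub>R (\<Sum>k<N. gradient f (xs + v k)))"
    and "a \<equiv> (\<Sum>k<N. gap (v k)) / real N"
  shows "(norm y)\<^sup>2 \<le> (p + 10 * R * a)\<^sup>2 / \<mu>\<^sup>2"
    and "f (xs + y) - f xs \<le> 3 / 2 * (p + 10 * R * a)\<^sup>2 / \<mu>"
proof -
  define s where "s = sqrt \<mu>"
  have s: "0 < s" "s\<^sup>2 = \<mu>" using \<mu>_pos by (auto simp: s_def)
  have a0: "0 \<le> a" unfolding a_def by (simp add: sum_nonneg gap_nonneg)
  have p0: "0 \<le> p" by (simp add: p_def)
  define W where "W = p + 10 * R * a"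
  have W0: "0 \<le> W" using a0 p0 R_pos by (simp add: W_def)
  have "(hnorm y)\<^sup>2 = (\<Sum>k<N. polar (v k) y) / N"
    by (simp only: polar_self[symmetric]) (simp add: y_def polar_scaleR_left polar_sum_left)
  also have "\<dots> \<le> (\<Sum>k<N. inner (gradient f (xs + v k)) y + 10 * (R / s) * hnorm y * gap (v k)) / N"
  proof (intro divide_right_mono sum_mono)
    fix k show "polar (v k) y \<le> inner (gradient f (xs + v k)) y + 10 * (R / s) * hnorm y * gap (v k)"
      using gradient_deviation[of "v k" y] by (simp add: s_def)
  qed simp
  also have "\<dots> = inner ((1 / real N) *\<^sub>R (\<Sum>k<N. gradient f (xs + v k))) y + 10 * (R / s) * hnorm y * a"
    by (simp add: sum.distrib add_divide_distrib inner_sum_left a_def sum_distrib_left sum_divide_distrib)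
  also have "inner ((1 / real N) *\<^sub>R (\<Sum>k<N. gradient f (xs + v k))) y \<le> p * norm y"
    unfolding p_def by (rule norm_cauchy_schwarz)
  also have "p * norm y \<le> p * (hnorm y / s)"
    using norm_le_hnorm[of y] s p0 by (intro mult_left_mono) (auto simp: s_def field_simps)
  finally have "hnorm y * hnorm y \<le> hnorm y * (W / s)"
    by (simp add: W_def power2_eq_square add_divide_distrib algebra_simps)
  then have hn: "hnorm y \<le> W / s"
    using W0 s hnorm_nonneg[of y] by (metis divide_nonneg_pos mult_left_le_imp_le order_le_less)
  have ny: "norm y \<le> W / \<mu>"
  proof -
    have "norm y \<le> hnorm y / s" using norm_le_hnorm[of y] s by (simp add: s_def field_simps)
    also have "\<dots> \<le> W / s / s" using hn s by (intro divide_right_mono) auto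
    finally show ?thesis using s(2) by (simp add: power2_eq_square)
  qed
  then have "(norm y)\<^sup>2 \<le> (W / \<mu>)\<^sup>2" by (intro power_mono) auto
  then show "(norm y)\<^sup>2 \<le> (p + 10 * R * a)\<^sup>2 / \<mu>\<^sup>2" by (simp add: W_def power_divide)
  show "f (xs + y) - f xs \<le> 3 / 2 * (p + 10 * R * a)\<^sup>2 / \<mu>"
  proof (cases "R * norm y \<le> 1")
    case True
    have "exp (R * norm y) \<le> exp 1" using True by simp
    also have "exp 1 \<le> (3::real)" using e_less_272 by simp
    finally have "exp (R * norm y) \<le> 3" .
    then have "exp (R * norm y) / 2 * curvature xs y \<le> 3 / 2 * (W / s)\<^sup>2"
      unfolding hnorm_square[symmetric] using hn by (intro mult_mono power_mono) auto
    then show ?thesis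
      using second_order_upper[of xs y] s by (simp add: gradient_minimum W_def power_divide)
  next
    case False
    have "f (xs + y) - f xs \<le> a"
    proof -
      have "(\<Sum>k<N. f (xs + y) + inner (gradient f (xs + y)) (v k - y)) \<le> (\<Sum>k<N. f xs + gap (v k))"
      proof (rule sum_mono)
        fix k show "f (xs + y) + inner (gradient f (xs + y)) (v k - y) \<le> f xs + gap (v k)"
          using gradient_inequality[of "xs + y" "v k - y"] value_le_gap[of "v k"] by simp
      qed
      moreover have "(\<Sum>k<N. v k - y) = 0"
        using N by (simp add: sum_subtractf y_def sum_constant_scaleR)
      then have "(\<Sum>k<N. inner (gradient f (xs + y)) (v k - y)) = 0"
        by (simp only: inner_sum_right[symmetric] inner_zero_right)
      ultimately have "real N * (f (xs + y) - f xs) \<le> real N * a"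
        using N by (simp only: sum.distrib) (simp add: a_def algebra_simps)
      then show ?thesis using N by simp
    qed
    also have "a \<le> a * (R * (W / \<mu>))"
    proof -
      have "R * norm y \<le> R * (W / \<mu>)" using ny R_pos by (intro mult_left_mono) auto
      then have "1 \<le> R * (W / \<mu>)" using False by linarith
      from mult_left_mono[OF this a0] show ?thesis by simp
    qed
    also have "\<dots> = (R * a) * W / \<mu>" by simp
    also have "\<dots> \<le> 3 / 2 * W\<^sup>2 / \<mu>"
    proof -
      have "R * a \<le> 3 / 2 * W" using a0 p0 R_pos by (simp add: W_def)
      then have "(R * a) * W \<le> 3 / 2 * W * W" using W0 by (rule mult_right_mono)
      then show ?thesis using \<mu>_pos unfolding power2_eq_square mult.assoc
        by (intro divide_right_mono) auto
    qed
    finally show ?thesis by (simp add: W_def)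
  qed
qed

end

section \<open>Strongly measurable functions\<close>

lemma strongly_measurable_const: "strongly_measurable M (\<lambda>_. c)"
  unfolding strongly_measurable_def by (intro exI[of _ "\<lambda>_ _. c"]) auto

lemma strongly_measurable_cong:
  assumes "\<And>\<omega>. \<omega> \<in> space M \<Longrightarrow> X \<omega> = Y \<omega>"
  shows "strongly_measurable M X \<longleftrightarrow> strongly_measurable M Y"
  unfolding strongly_measurable_def using assms by simp

lemma strongly_measurable_continuous2:
  assumes X: "strongly_measurable M X" and Y: "strongly_measurable M Y"
    and h: "continuous_on UNIV (\<lambda>p. h (fst p) (snd p))"
  shows "strongly_measurable M (\<lambda>\<omega>. h (X \<omega>) (Y \<omega>))"
proof -
  obtain s t where s: "\<And>i::nat. simple_function M (s i)" "\<And>\<omega>. \<omega> \<in> space M \<Longrightarrow> (\<lambda>i. s i \<omega>) \<longlonglongrightarrow> X \<omega>"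
    and t: "\<And>i::nat. simple_function M (t i)" "\<And>\<omega>. \<omega> \<in> space M \<Longrightarrow> (\<lambda>i. t i \<omega>) \<longlonglongrightarrow> Y \<omega>"
    using X Y unfolding strongly_measurable_def by blast
  have "(\<lambda>i. h (s i \<omega>) (t i \<omega>)) \<longlonglongrightarrow> h (X \<omega>) (Y \<omega>)" if "\<omega> \<in> space M" for \<omega>
    using continuous_on_tendsto_compose[OF h tendsto_Pair[OF s(2)[OF that] t(2)[OF that]]] by simp
  moreover have "simple_function M (\<lambda>\<omega>. h (s i \<omega>) (t i \<omega>))" for i
    by (rule simple_function_compose2[OF s(1) t(1)])
  ultimately show ?thesis unfolding strongly_measurable_def by (intro exI[of _ "\<lambda>i \<omega>. h (s i \<omega>) (t i \<omega>)"]) auto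
qed

lemma strongly_measurable_continuous:
  assumes "strongly_measurable M X" "continuous_on UNIV h"
  shows "strongly_measurable M (\<lambda>\<omega>. h (X \<omega>))"
  by (rule strongly_measurable_continuous2[OF assms(1) assms(1), where h = "\<lambda>x _. h x"])
    (auto intro!: continuous_intros continuous_on_compose2[OF assms(2)])

lemma
  fixes X Y :: "'w \<Rightarrow> 'h::real_inner"
  assumes X: "strongly_measurable M X" and Y: "strongly_measurable M Y"
  shows strongly_measurable_add: "strongly_measurable M (\<lambda>\<omega>. X \<omega> + Y \<omega>)"
    and strongly_measurable_diff: "strongly_measurable M (\<lambda>\<omega>. X \<omega> - Y \<omega>)"
    and borel_measurable_inner_strong: "(\<lambda>\<omega>. inner (X \<omega>) (Y \<omega>)) \<in> borel_measurable M"
  unfolding strongly_measurable_iff_borel_measurable[symmetric]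
  by (rule strongly_measurable_continuous2[OF X Y], intro continuous_intros)+

lemma strongly_measurable_scaleR:
  fixes X :: "'w \<Rightarrow> 'h::real_normed_vector"
  assumes c: "c \<in> borel_measurable M" and X: "strongly_measurable M X"
  shows "strongly_measurable M (\<lambda>\<omega>. c \<omega> *\<^sub>R X \<omega>)"
  by (rule strongly_measurable_continuous2[OF c[folded strongly_measurable_iff_borel_measurable] X])
    (intro continuous_intros)

lemma strongly_measurable_sum:
  fixes X :: "'i \<Rightarrow> 'w \<Rightarrow> 'h::real_inner"
  assumes "\<And>i. i \<in> I \<Longrightarrow> strongly_measurable M (X i)"
  shows "strongly_measurable M (\<lambda>\<omega>. \<Sum>i\<in>I. X i \<omega>)"
  using assms
  by (induction I rule: infinite_finite_induct)
    (auto intro: strongly_measurable_const strongly_measurable_add)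

lemma borel_measurable_norm_strong:
  fixes X :: "'w \<Rightarrow> 'h::real_normed_vector"
  assumes "strongly_measurable M X"
  shows "(\<lambda>\<omega>. norm (X \<omega>)) \<in> borel_measurable M"
  using strongly_measurable_continuous[OF assms, of norm]
  by (simp add: strongly_measurable_iff_borel_measurable continuous_on_norm_id)

lemma simple_function_subalgebra:
  assumes "subalgebra M G" "simple_function G s"
  shows "simple_function M s"
  using assms unfolding simple_function_def subalgebra_def by auto

lemma strongly_measurable_subalgebra:
  assumes "subalgebra M G" "strongly_measurable G X"
  shows "strongly_measurable M X"
  using assms simple_function_subalgebra[OF assms(1)] unfolding strongly_measurable_def subalgebra_def by metis

lemma borel_measurable_evaluation_simple:
  fixes g :: "'w \<Rightarrow> 'h \<Rightarrow> real"
  assumes g: "\<And>x. (\<lambda>\<omega>. g \<omega> x) \<in> borel_measurable M" and s: "simple_function M s"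
  shows "(\<lambda>\<omega>. g \<omega> (s \<omega>)) \<in> borel_measurable M"
proof (rule measurable_compose_countable'[where f = "\<lambda>x \<omega>. g \<omega> x" and g = s])
  show "s \<in> measurable M (count_space (s ` space M))"
    using s unfolding simple_function_def by (subst measurable_count_space_eq2) auto
  show "countable (s ` space M)" using s by (auto simp: simple_function_def intro: countable_finite)
qed (rule g)

text \<open>A function that is measurable in \<open>\<omega>\<close> for each fixed point and continuous in the point is
  approximated by its values along simple functions converging to \<open>V\<close>.\<close>

lemma borel_measurable_evaluation:
  fixes g :: "'w \<Rightarrow> 'h::metric_space \<Rightarrow> real"
  assumes g: "\<And>x. (\<lambda>\<omega>. g \<omega> x) \<in> borel_measurable M"
    and cont: "\<And>\<omega>. \<omega> \<in> space M \<Longrightarrow> continuous_on UNIV (g \<omega>)"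
    and V: "strongly_measurable M V"
  shows "(\<lambda>\<omega>. g \<omega> (V \<omega>)) \<in> borel_measurable M"
proof -
  obtain s where s: "\<And>i::nat. simple_function M (s i)" "\<And>\<omega>. \<omega> \<in> space M \<Longrightarrow> (\<lambda>i. s i \<omega>) \<longlonglongrightarrow> V \<omega>"
    using V unfolding strongly_measurable_def by blast
  show ?thesis
  proof (rule borel_measurable_LIMSEQ_real)
    show "(\<lambda>i. g \<omega> (s i \<omega>)) \<longlonglongrightarrow> g \<omega> (V \<omega>)" if "\<omega> \<in> space M" for \<omega>
      using continuous_on_tendsto_compose[OF cont[OF that] s(2)[OF that]] by simp
    show "(\<lambda>\<omega>. g \<omega> (s i \<omega>)) \<in> borel_measurable M" for i
      by (rule borel_measurable_evaluation_simple[OF g s(1)])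
  qed
qed

lemma difference_quotient_gradient:
  fixes f :: "'h::{real_inner, complete_space} \<Rightarrow> real"
  assumes "f differentiable (at x)"
  shows "(\<lambda>k. real (Suc k) * (f (x + (1 / real (Suc k)) *\<^sub>R h) - f x)) \<longlonglongrightarrow> inner h (gradient f x)"
proof -
  have "(f has_derivative (\<lambda>k. inner k (gradient f x))) (at (x + 0 *\<^sub>R h))"
    using GDERIV_gradient[OF assms] unfolding gderiv_def by simp
  then have "((\<lambda>t. f (x + t *\<^sub>R h)) has_derivative (\<lambda>s. inner (s *\<^sub>R h) (gradient f x))) (at 0)"
    by (rule has_derivative_compose[rotated]) (auto intro!: derivative_eq_intros)
  then have "((\<lambda>t. f (x + t *\<^sub>R h)) has_real_derivative inner h (gradient f x)) (at 0)"
    unfolding has_field_derivative_def by (rule has_derivative_eq_rhs) (auto simp: mult.commute)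
  then have *: "(\<lambda>t. (f (x + t *\<^sub>R h) - f x) / t) \<midarrow>0\<rightarrow> inner h (gradient f x)"
    by (simp add: DERIV_def)
  have "filterlim (\<lambda>k. 1 / real (Suc k)) (at 0) sequentially"
    unfolding filterlim_at using LIMSEQ_inverse_real_of_nat by (auto simp: inverse_eq_divide)
  from filterlim_compose[OF * this] show ?thesis by (simp add: mult.commute)
qed

lemma borel_measurable_inner_gradient:
  fixes g :: "'w \<Rightarrow> 'h::{real_inner, complete_space} \<Rightarrow> real"
  assumes g: "\<And>x. (\<lambda>\<omega>. g \<omega> x) \<in> borel_measurable M"
    and diff: "\<And>\<omega> x. \<omega> \<in> space M \<Longrightarrow> g \<omega> differentiable (at x)"
    and V: "strongly_measurable M V"
  shows "(\<lambda>\<omega>. inner h (gradient (g \<omega>) (V \<omega>))) \<in> borel_measurable M"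
proof (rule borel_measurable_LIMSEQ_real)
  have cont: "continuous_on UNIV (g \<omega>)" if "\<omega> \<in> space M" for \<omega>
    using diff[OF that] by (intro differentiable_imp_continuous_on) (auto simp: differentiable_on_def)
  show "(\<lambda>k. real (Suc k) * (g \<omega> (V \<omega> + (1 / real (Suc k)) *\<^sub>R h) - g \<omega> (V \<omega>)))
      \<longlonglongrightarrow> inner h (gradient (g \<omega>) (V \<omega>))" if "\<omega> \<in> space M" for \<omega>
    by (rule difference_quotient_gradient[OF diff[OF that]])
  have "strongly_measurable M (\<lambda>\<omega>. V \<omega> + (1 / real (Suc k)) *\<^sub>R h)" for k
    by (intro strongly_measurable_add V strongly_measurable_const)
  then show "(\<lambda>\<omega>. real (Suc k) * (g \<omega> (V \<omega> + (1 / real (Suc k)) *\<^sub>R h) - g \<omega> (V \<omega>)))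
      \<in> borel_measurable M" for k
    by (intro borel_measurable_times borel_measurable_diff borel_measurable_const
      borel_measurable_evaluation[OF g cont] V)
qed

text \<open>
  Pettis' argument. Strong measurability with respect to the larger sigma-algebra provides a countable
  set \<open>D\<close> whose closure contains all values. Norms of such values are determined by their inner
  products with elements of \<open>D\<close>, hence distances to elements of \<open>D\<close> are measurable for \<open>G\<close>, and the
  nearest among the first elements of \<open>D\<close> is a simple approximation.\<close>

lemma strongly_measurable_if_weakly_measurable:
  fixes X :: "'w \<Rightarrow> 'h::real_inner"
  assumes sub: "subalgebra M G" and X: "strongly_measurable M X"
    and weak: "\<And>h. (\<lambda>\<omega>. inner h (X \<omega>)) \<in> borel_measurable G"
  shows "strongly_measurable G X"
proof -
  have sp: "space G = space M" using sub by (simp add: subalgebra_def)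
  obtain s where s: "\<And>i::nat. simple_function M (s i)" "\<And>\<omega>. \<omega> \<in> space M \<Longrightarrow> (\<lambda>i. s i \<omega>) \<longlonglongrightarrow> X \<omega>"
    using X unfolding strongly_measurable_def by blast
  define D where "D = insert 0 (\<Union>i. s i ` space M)"
  have "countable D"
    unfolding D_def using s(1)
    by (intro countable_insert countable_UN) (auto simp: simple_function_def intro: countable_finite)
  define d where "d = from_nat_into D"
  have ran: "range d = D" unfolding d_def using \<open>countable D\<close> by (simp add: D_def range_from_nat_into)
  have sD: "s i \<omega> \<in> D" if "\<omega> \<in> space M" for i \<omega> using that by (auto simp: D_def)
  have norm_le_iff: "norm (X \<omega>) \<le> c \<longleftrightarrow> (\<forall>j. inner (d j) (X \<omega>) \<le> norm (d j) * c)"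
    if \<omega>: "\<omega> \<in> space M" and "0 \<le> c" for \<omega> c
  proof
    assume c: "norm (X \<omega>) \<le> c"
    show "\<forall>j. inner (d j) (X \<omega>) \<le> norm (d j) * c"
    proof
      fix j have "inner (d j) (X \<omega>) \<le> norm (d j) * norm (X \<omega>)" by (rule norm_cauchy_schwarz)
      also have "\<dots> \<le> norm (d j) * c" using c by (intro mult_left_mono) auto
      finally show "inner (d j) (X \<omega>) \<le> norm (d j) * c" .
    qed
  next
    assume le: "\<forall>j. inner (d j) (X \<omega>) \<le> norm (d j) * c"
    have "inner (s i \<omega>) (X \<omega>) \<le> norm (s i \<omega>) * c" for i
    proof -
      have "s i \<omega> \<in> range d" using sD[OF \<omega>] ran by simp
      then obtain j where "s i \<omega> = d j" by blast
      then show ?thesis using le by simp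
    qed
    then have "inner (X \<omega>) (X \<omega>) \<le> norm (X \<omega>) * c"
      by (intro LIMSEQ_le[OF tendsto_inner[OF s(2)[OF that(1)] tendsto_const]
          tendsto_mult[OF tendsto_norm[OF s(2)[OF that(1)]] tendsto_const]]) blast
    then have "norm (X \<omega>) * norm (X \<omega>) \<le> norm (X \<omega>) * c"
      by (simp add: power2_norm_eq_inner[symmetric] power2_eq_square)
    then show "norm (X \<omega>) \<le> c"
      using that(2) by (cases "norm (X \<omega>) = 0") (simp_all add: mult_le_cancel_left)
  qed
  have norm_meas: "(\<lambda>\<omega>. norm (X \<omega>)) \<in> borel_measurable G"
  proof (subst borel_measurable_iff_le, intro allI)
    fix c :: real
    show "{\<omega> \<in> space G. norm (X \<omega>) \<le> c} \<in> sets G"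
    proof (cases "0 \<le> c")
      case True
      have "{\<omega> \<in> space G. norm (X \<omega>) \<le> c} = {\<omega> \<in> space G. \<forall>j. inner (d j) (X \<omega>) \<le> norm (d j) * c}"
        using norm_le_iff True sp by auto
      also have "\<dots> \<in> sets G" using weak by measurable
      finally show ?thesis .
    next
      case False
      then have "\<not> norm (X \<omega>) \<le> c" for \<omega> using norm_ge_zero[of "X \<omega>"] by linarith
      then have "{\<omega> \<in> space G. norm (X \<omega>) \<le> c} = {}" by blast
      then show ?thesis by (metis sets.empty_sets)
    qed
  qed
  have dist_meas: "(\<lambda>\<omega>. dist (d j) (X \<omega>)) \<in> borel_measurable G" for j
  proof -
    have eq: "dist (d j) (X \<omega>) = sqrt ((norm (d j))\<^sup>2 - 2 * inner (d j) (X \<omega>) + (norm (X \<omega>))\<^sup>2)" for \<omega>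
    proof -
      have "(norm (d j - X \<omega>))\<^sup>2 = (norm (d j))\<^sup>2 - 2 * inner (d j) (X \<omega>) + (norm (X \<omega>))\<^sup>2"
        unfolding power2_norm_eq_inner inner_diff_left inner_diff_right
        by (simp add: inner_commute[of "X \<omega>" "d j"])
      then show ?thesis unfolding dist_norm by (intro real_sqrt_unique[symmetric] norm_ge_zero)
    qed
    have "(\<lambda>\<omega>. sqrt (c - 2 * a \<omega> + (b \<omega>)\<^sup>2)) \<in> borel_measurable G"
      if "a \<in> borel_measurable G" "b \<in> borel_measurable G" for a b :: "'w \<Rightarrow> real" and c
      using that by measurable
    from this[OF weak norm_meas] show ?thesis by (simp only: eq)
  qed
  define r where "r j \<omega> = dist (d j) (X \<omega>)" for j \<omega>
  have r_meas [measurable]: "r j \<in> borel_measurable G" for j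
    unfolding r_def by (rule dist_meas)
  define J where "J n \<omega> = (LEAST j. j \<le> n \<and> (\<forall>i\<in>{..n}. r j \<omega> \<le> r i \<omega>))" for n \<omega>
  have J: "J n \<omega> \<le> n \<and> (\<forall>i\<in>{..n}. r (J n \<omega>) \<omega> \<le> r i \<omega>)" for n \<omega>
  proof -
    obtain j where "j \<le> n \<and> (\<forall>i\<in>{..n}. r j \<omega> \<le> r i \<omega>)"
      using ex_is_arg_min_if_finite[of "{..n}" "\<lambda>i. r i \<omega>"]
      unfolding is_arg_min_linorder by (metis atMost_iff empty_iff finite_atMost order_refl)
    then show ?thesis unfolding J_def by (rule LeastI)
  qed
  have J_meas: "J n \<in> measurable G (count_space UNIV)" for n
    unfolding J_def by measurable
  have "simple_function G (J n)" for n
    unfolding simple_function_def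
  proof
    have "J n ` space G \<subseteq> {..n}" using J by auto
    then show "finite (J n ` space G)" using finite_subset by blast
    show "\<forall>x\<in>J n ` space G. J n -` {x} \<inter> space G \<in> sets G"
      using measurable_sets[OF J_meas] by simp
  qed
  then have "simple_function G (\<lambda>\<omega>. d (J n \<omega>))" for n
    by (rule simple_function_compose1)
  moreover have "(\<lambda>n. d (J n \<omega>)) \<longlonglongrightarrow> X \<omega>" if \<omega>: "\<omega> \<in> space G" for \<omega>
  proof (rule metric_LIMSEQ_I)
    fix e :: real assume "0 < e"
    then obtain i where "dist (s i \<omega>) (X \<omega>) < e"
      using metric_LIMSEQ_D[OF s(2)] \<omega> sp by blast
    moreover obtain j where "d j = s i \<omega>"
      using sD[of \<omega> i] \<omega> unfolding sp ran[symmetric] by (metis imageE)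
    ultimately have "dist (d (J n \<omega>)) (X \<omega>) < e" if "n \<ge> j" for n
      using J[of n \<omega>] that by (metis r_def atMost_iff le_less_trans)
    then show "\<exists>no. \<forall>n\<ge>no. dist (d (J n \<omega>)) (X \<omega>) < e" by blast
  qed
  ultimately show ?thesis unfolding strongly_measurable_def
    by (intro exI[of _ "\<lambda>n \<omega>. d (J n \<omega>)"]) auto
qed

section \<open>Random functions with almost surely bounded gradients\<close>

text \<open>The gauge integral of a derivative that exists everywhere is the increment of the function, and
  this integral ignores null sets.\<close>

lemma increment_le_if_AE_derivative_le:
  fixes \<phi> :: "real \<Rightarrow> real"
  assumes deriv: "\<And>t. (\<phi> has_real_derivative \<phi>' t) (at t)"
    and AE: "AE t in lborel. \<bar>\<phi>' t\<bar> \<le> C" and C: "0 \<le> C"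
  shows "\<bar>\<phi> 1 - \<phi> 0\<bar> \<le> C"
proof -
  obtain N where N: "{t. \<not> \<bar>\<phi>' t\<bar> \<le> C} \<subseteq> N" "N \<in> null_sets lborel"
    using AE by (auto simp: eventually_ae_filter)
  then have neg: "negligible N"
    by (simp add: negligible_iff_null_sets null_sets_completionI)
  have "(\<phi>' has_integral \<phi> 1 - \<phi> 0) {0..1}"
    by (rule fundamental_theorem_of_calculus)
      (auto intro!: has_field_derivative_at_within deriv simp flip: has_real_derivative_iff_has_vector_derivative)
  then have spike: "((\<lambda>t. if t \<in> N then 0 else \<phi>' t) has_integral \<phi> 1 - \<phi> 0) {0..1}"
    by (rule has_integral_spike[OF neg, rotated]) auto
  have "norm (if t \<in> N then 0 else \<phi>' t) \<le> C" for t
    using N(1) C by auto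
  then have "norm (\<phi> 1 - \<phi> 0) \<le> C * measure lborel {0..1::real}"
    by (intro has_integral_bound_real[OF C finite.emptyI spike])
  then show ?thesis by simp
qed

context
  fixes M :: "'w measure" and g :: "'w \<Rightarrow> 'h::{real_inner, complete_space} \<Rightarrow> real" and C :: real
  assumes prob: "prob_space M"
    and meas: "\<And>x. (\<lambda>\<omega>. g \<omega> x) \<in> borel_measurable M"
    and diff: "\<And>\<omega> x. \<omega> \<in> space M \<Longrightarrow> g \<omega> differentiable (at x)"
    and C0: "0 \<le> C"
    and bounded: "\<And>x. AE \<omega> in M. norm (gradient (g \<omega>) x) \<le> C"
begin

text \<open>For each \<open>t\<close> the derivative along the segment is bounded for almost every \<open>\<omega>\<close>; by Fubini's theorem
  it is bounded, for almost every \<open>\<omega>\<close>, at almost every \<open>t\<close>.\<close>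

lemma AE_increment_le: "AE \<omega> in M. \<bar>g \<omega> (x + h) - g \<omega> x\<bar> \<le> C * norm h"
proof -
  interpret prob_space M by (rule prob)
  interpret pair_sigma_finite M lborel ..
  define D where "D p = inner h (gradient (g (fst p)) (x + snd p *\<^sub>R h))" for p :: "'w \<times> real"
  have "D \<in> borel_measurable (M \<Otimes>\<^sub>M lborel)"
    unfolding D_def
  proof (rule borel_measurable_inner_gradient)
    show "(\<lambda>p. g (fst p) y) \<in> borel_measurable (M \<Otimes>\<^sub>M lborel)" for y
      by (rule measurable_compose[OF measurable_fst meas])
    show "strongly_measurable (M \<Otimes>\<^sub>M lborel) (\<lambda>p. x + snd p *\<^sub>R h)"
      by (intro strongly_measurable_add strongly_measurable_const strongly_measurable_scaleR) simp
  qed (auto simp: space_pair_measure diff)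
  then have "{p \<in> space (M \<Otimes>\<^sub>M lborel). \<bar>D p\<bar> \<le> C * norm h} \<in> sets (M \<Otimes>\<^sub>M lborel)"
    by measurable
  moreover have "AE t in lborel. AE \<omega> in M. \<bar>D (\<omega>, t)\<bar> \<le> C * norm h"
  proof (rule AE_I2)
    fix t
    show "AE \<omega> in M. \<bar>D (\<omega>, t)\<bar> \<le> C * norm h"
      using bounded[of "x + t *\<^sub>R h"]
    proof eventually_elim
      case (elim \<omega>)
      have "\<bar>D (\<omega>, t)\<bar> \<le> norm h * norm (gradient (g \<omega>) (x + t *\<^sub>R h))"
        unfolding D_def by (simp add: Cauchy_Schwarz_ineq2)
      also have "\<dots> \<le> norm h * C" using elim by (intro mult_left_mono) auto
      finally show ?case by (simp add: mult.commute)
    qed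
  qed
  ultimately have "AE \<omega> in M. AE t in lborel. \<bar>D (\<omega>, t)\<bar> \<le> C * norm h"
    by (subst AE_commute) auto
  then show ?thesis
    using AE_space
  proof eventually_elim
    case (elim \<omega>)
    have "((\<lambda>t. g \<omega> (x + t *\<^sub>R h)) has_real_derivative D (\<omega>, t)) (at t)" for t
    proof -
      have "(g \<omega> has_derivative (\<lambda>k. inner k (gradient (g \<omega>) (x + t *\<^sub>R h)))) (at (x + t *\<^sub>R h))"
        using GDERIV_gradient[OF diff] elim(2) unfolding gderiv_def by blast
      then have "((\<lambda>t. g \<omega> (x + t *\<^sub>R h)) has_derivative (\<lambda>s. inner (s *\<^sub>R h) (gradient (g \<omega>) (x + t *\<^sub>R h)))) (at t)"
        by (rule has_derivative_compose[rotated]) (auto intro!: derivative_eq_intros)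
      then show ?thesis
        unfolding has_field_derivative_def D_def by (rule has_derivative_eq_rhs) (auto simp: mult.commute)
    qed
    from increment_le_if_AE_derivative_le[OF this elim(1)] show ?case using C0 by simp
  qed
qed

text \<open>Simple approximations \<open>s\<close> of \<open>V\<close> and \<open>t\<close> of the gradient take countably many values, so the
  preceding estimate holds simultaneously for all increments from \<open>s i \<omega>\<close> in direction \<open>t i \<omega>\<close>. It
  survives the limit in \<open>i\<close> and then says that the derivative at \<open>V \<omega>\<close> in the direction of the
  gradient, the squared norm of the gradient, is at most \<open>C\<close> times that norm.\<close>

lemma AE_norm_gradient_le:
  assumes V: "strongly_measurable M V"
    and X: "strongly_measurable M (\<lambda>\<omega>. gradient (g \<omega>) (V \<omega>))"
  shows "AE \<omega> in M. norm (gradient (g \<omega>) (V \<omega>)) \<le> C"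
proof -
  obtain s where s: "\<And>i::nat. simple_function M (s i)" "\<And>\<omega>. \<omega> \<in> space M \<Longrightarrow> (\<lambda>i. s i \<omega>) \<longlonglongrightarrow> V \<omega>"
    using V unfolding strongly_measurable_def by blast
  obtain t where t: "\<And>i::nat. simple_function M (t i)"
      "\<And>\<omega>. \<omega> \<in> space M \<Longrightarrow> (\<lambda>i. t i \<omega>) \<longlonglongrightarrow> gradient (g \<omega>) (V \<omega>)"
    using X unfolding strongly_measurable_def by blast
  have "AE \<omega> in M. \<forall>x\<in>s i ` space M. \<forall>y\<in>t i ` space M.
      \<bar>g \<omega> (x + (1 / real (Suc k)) *\<^sub>R y) - g \<omega> x\<bar> \<le> C * norm ((1 / real (Suc k)) *\<^sub>R y)" for i k
    using s(1)[of i] t(1)[of i]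
    by (intro AE_finite_allI AE_increment_le) (auto simp: simple_function_def)
  then have "AE \<omega> in M. \<forall>i k. \<forall>x\<in>s i ` space M. \<forall>y\<in>t i ` space M.
      \<bar>g \<omega> (x + (1 / real (Suc k)) *\<^sub>R y) - g \<omega> x\<bar> \<le> C * norm ((1 / real (Suc k)) *\<^sub>R y)"
    by (simp add: AE_all_countable)
  then show ?thesis
    using AE_space
  proof eventually_elim
    case (elim \<omega>)
    let ?X = "gradient (g \<omega>) (V \<omega>)"
    have cont: "continuous_on UNIV (g \<omega>)"
      using diff[OF elim(2)] by (intro differentiable_imp_continuous_on) (auto simp: differentiable_on_def)
    have lim: "(\<lambda>i. g \<omega> (s i \<omega> + c *\<^sub>R t i \<omega>) - g \<omega> (s i \<omega>)) \<longlonglongrightarrow> g \<omega> (V \<omega> + c *\<^sub>R ?X) - g \<omega> (V \<omega>)" for c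
      using elim(2) by (intro tendsto_diff continuous_on_tendsto_compose[OF cont] tendsto_add tendsto_scaleR
          tendsto_const s(2) t(2)) auto
    have incr: "\<bar>g \<omega> (V \<omega> + c *\<^sub>R ?X) - g \<omega> (V \<omega>)\<bar> \<le> C * norm (c *\<^sub>R ?X)" if "c = 1 / real (Suc k)" for c k
    proof (rule tendsto_le[OF sequentially_bot])
      show "(\<lambda>i. C * norm (c *\<^sub>R t i \<omega>)) \<longlonglongrightarrow> C * norm (c *\<^sub>R ?X)"
        using elim(2) by (intro tendsto_intros t(2))
      show "(\<lambda>i. \<bar>g \<omega> (s i \<omega> + c *\<^sub>R t i \<omega>) - g \<omega> (s i \<omega>)\<bar>) \<longlonglongrightarrow> \<bar>g \<omega> (V \<omega> + c *\<^sub>R ?X) - g \<omega> (V \<omega>)\<bar>"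
        by (rule tendsto_rabs[OF lim])
      show "\<forall>\<^sub>F i in sequentially. \<bar>g \<omega> (s i \<omega> + c *\<^sub>R t i \<omega>) - g \<omega> (s i \<omega>)\<bar> \<le> C * norm (c *\<^sub>R t i \<omega>)"
        using elim unfolding that by (intro always_eventually) blast
    qed
    have le: "real (Suc k) * (g \<omega> (V \<omega> + (1 / real (Suc k)) *\<^sub>R ?X) - g \<omega> (V \<omega>)) \<le> C * norm ?X" for k
    proof -
      have "g \<omega> (V \<omega> + (1 / real (Suc k)) *\<^sub>R ?X) - g \<omega> (V \<omega>) \<le> C * (norm ?X / real (Suc k))"
        using abs_le_D1[OF incr[OF refl, of k]] by simp
      from mult_left_mono[OF this, of "real (Suc k)"] show ?thesis by simp
    qed
    have "inner ?X ?X \<le> C * norm ?X"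
      by (rule LIMSEQ_le_const2[OF difference_quotient_gradient[OF diff[OF elim(2)]]]) (use le in blast)
    then have "norm ?X * norm ?X \<le> C * norm ?X"
      by (simp add: power2_norm_eq_inner[symmetric] power2_eq_square)
    then show ?case using C0 by (cases "?X = 0") auto
  qed
qed

end

section \<open>Essentially bounded random vectors\<close>

text \<open>The bound is taken with respect to \<open>M\<close> and the measurability with respect to \<open>G\<close>, since \<open>G\<close> will be a
  member of a filtration, whose measure carries no information.\<close>

definition bounded_measurable :: "'w measure \<Rightarrow> 'w measure \<Rightarrow> ('w \<Rightarrow> 'h::real_inner) \<Rightarrow> bool" where
  "bounded_measurable M G Z \<longleftrightarrow> strongly_measurable G Z \<and> (\<exists>K. AE \<omega> in M. norm (Z \<omega>) \<le> K)"

lemma bounded_measurable_const: "bounded_measurable M G (\<lambda>_. c)"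
  unfolding bounded_measurable_def by (auto intro: strongly_measurable_const)

lemma bounded_measurable_combine:
  fixes h :: "'a::real_inner \<Rightarrow> 'b::real_inner \<Rightarrow> 'c::real_inner"
  assumes Y: "bounded_measurable M G Y" and Z: "bounded_measurable M G Z"
    and h: "continuous_on UNIV (\<lambda>p. h (fst p) (snd p))"
    and bound: "\<And>K L x y. norm x \<le> K \<Longrightarrow> norm y \<le> L \<Longrightarrow> norm (h x y) \<le> b K L"
  shows "bounded_measurable M G (\<lambda>\<omega>. h (Y \<omega>) (Z \<omega>))"
proof -
  obtain K L where "AE \<omega> in M. norm (Y \<omega>) \<le> K" "AE \<omega> in M. norm (Z \<omega>) \<le> L"
    using Y Z unfolding bounded_measurable_def by blast
  then have "AE \<omega> in M. norm (h (Y \<omega>) (Z \<omega>)) \<le> b K L"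
    by eventually_elim (rule bound)
  then show ?thesis
    using Y Z strongly_measurable_continuous2[OF _ _ h] unfolding bounded_measurable_def by blast
qed

lemma bounded_measurable_add:
  "bounded_measurable M G Y \<Longrightarrow> bounded_measurable M G Z \<Longrightarrow> bounded_measurable M G (\<lambda>\<omega>. Y \<omega> + Z \<omega>)"
  by (rule bounded_measurable_combine[where b = "(+)"])
    (auto intro!: continuous_intros intro: norm_triangle_mono)

lemma bounded_measurable_diff:
  "bounded_measurable M G Y \<Longrightarrow> bounded_measurable M G Z \<Longrightarrow> bounded_measurable M G (\<lambda>\<omega>. Y \<omega> - Z \<omega>)"
  by (rule bounded_measurable_combine[where b = "(+)"])
    (auto intro!: continuous_intros intro: order_trans[OF norm_triangle_ineq4] add_mono)

lemma bounded_measurable_scaleR: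
  "bounded_measurable M G Y \<Longrightarrow> bounded_measurable M G Z \<Longrightarrow> bounded_measurable M G (\<lambda>\<omega>. Y \<omega> *\<^sub>R Z \<omega>)"
  by (rule bounded_measurable_combine[where b = "(*)"])
    (auto intro!: continuous_intros mult_mono intro: order_trans[OF abs_ge_zero])

lemma bounded_measurable_inner:
  "bounded_measurable M G Y \<Longrightarrow> bounded_measurable M G Z \<Longrightarrow> bounded_measurable M G (\<lambda>\<omega>. inner (Y \<omega>) (Z \<omega>))"
proof (rule bounded_measurable_combine[where b = "(*)" and h = inner])
  fix K L and x y :: 'b assume "norm x \<le> K" "norm y \<le> L"
  then have "norm x * norm y \<le> K * L" by (intro mult_mono) (auto intro: order_trans[OF norm_ge_zero])
  then show "norm (inner x y) \<le> K * L" using Cauchy_Schwarz_ineq2[of x y] by simp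
qed (assumption | intro continuous_intros)+

lemma bounded_measurable_sum:
  "(\<And>i. i \<in> I \<Longrightarrow> bounded_measurable M G (Z i)) \<Longrightarrow> bounded_measurable M G (\<lambda>\<omega>. \<Sum>i\<in>I. Z i \<omega>)"
  by (induction I rule: infinite_finite_induct)
    (auto intro: bounded_measurable_const bounded_measurable_add)

lemma bounded_measurable_subalgebra:
  "subalgebra H G \<Longrightarrow> bounded_measurable M G Z \<Longrightarrow> bounded_measurable M H Z"
  unfolding bounded_measurable_def using strongly_measurable_subalgebra by blast

lemma bounded_measurable_cong:
  assumes "\<And>\<omega>. \<omega> \<in> space M \<Longrightarrow> Y \<omega> = Z \<omega>" "space G = space M"
  shows "bounded_measurable M G Y \<longleftrightarrow> bounded_measurable M G Z"
proof -
  have "(AE \<omega> in M. norm (Y \<omega>) \<le> K) \<longleftrightarrow> (AE \<omega> in M. norm (Z \<omega>) \<le> K)" for K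
    by (intro AE_cong) (simp add: assms)
  then show ?thesis unfolding bounded_measurable_def using strongly_measurable_cong[of G Y Z] assms by simp
qed

lemma (in finite_measure) integrable_bounded_measurable:
  fixes Z :: "'a \<Rightarrow> real"
  assumes "bounded_measurable M M Z" shows "integrable M Z"
  using assms integrable_const_bound
  unfolding bounded_measurable_def strongly_measurable_iff_borel_measurable by blast

text \<open>The conditional expectation is given weakly, against fixed vectors. For a simple \<open>V\<close> the claim
  is a finite sum of such tests; the general case follows by dominated convergence along simple
  approximations, truncated to be uniformly bounded.\<close>

lemma (in prob_space) expectation_inner_noise_eq_0:
  fixes X Y V :: "'a \<Rightarrow> 'h::{real_inner, complete_space}"
  assumes sub: "subalgebra M G" and ce: "is_cond_exp M G X Y"
    and V: "bounded_measurable M G V"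
    and X: "bounded_measurable M M X" and Y: "bounded_measurable M G Y"
  shows "expectation (\<lambda>\<omega>. inner (V \<omega>) (X \<omega> - Y \<omega>)) = 0"
proof -
  interpret sub: finite_measure_subalgebra M G
    by unfold_locales (use sub in auto)
  have sp: "space G = space M" using sub by (simp add: subalgebra_def)
  have Y': "bounded_measurable M M Y" using bounded_measurable_subalgebra[OF sub Y] .
  have noise: "bounded_measurable M M (\<lambda>\<omega>. X \<omega> - Y \<omega>)"
    by (rule bounded_measurable_diff[OF X Y'])
  obtain C where C: "AE \<omega> in M. norm (X \<omega> - Y \<omega>) \<le> C"
    using noise unfolding bounded_measurable_def by blast
  obtain K0 where K0: "AE \<omega> in M. norm (V \<omega>) \<le> K0"
    using V unfolding bounded_measurable_def by blast
  \<comment> \<open>The extra 1 makes the truncation at \<open>K\<close> eventually ineffective at almost every \<open>\<omega>\<close>.\<close>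
  define K where "K = \<bar>K0\<bar> + 1"
  obtain s where s: "\<And>i::nat. simple_function G (s i)" "\<And>\<omega>. \<omega> \<in> space M \<Longrightarrow> (\<lambda>i. s i \<omega>) \<longlonglongrightarrow> V \<omega>"
    using V sp unfolding bounded_measurable_def strongly_measurable_def by blast
  define t where "t i \<omega> = (if norm (s i \<omega>) \<le> K then s i \<omega> else 0)" for i \<omega>
  have t_simple: "simple_function G (t i)" for i
    unfolding t_def by (rule simple_function_compose1[OF s(1), where g = "\<lambda>x. if norm x \<le> K then x else 0"])
  have t_le: "norm (t i \<omega>) \<le> K" for i \<omega> by (simp add: t_def K_def)
  have test: "expectation (\<lambda>\<omega>. indicator A \<omega> * inner h (X \<omega> - Y \<omega>)) = 0" if A: "A \<in> sets G" for A h
  proof -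
    have Xi: "integrable M (\<lambda>\<omega>. inner h (X \<omega>))" and Yi: "integrable M (\<lambda>\<omega>. inner h (Y \<omega>))"
      by (intro integrable_bounded_measurable bounded_measurable_inner bounded_measurable_const X Y')+
    have AM: "A \<in> sets M" using A sub by (auto simp: subalgebra_def)
    have "(\<integral>\<omega>. indicator A \<omega> * inner h (X \<omega>) \<partial>M) = (\<integral>\<omega>. indicator A \<omega> * real_cond_exp M G (\<lambda>\<omega>. inner h (X \<omega>)) \<omega> \<partial>M)"
      using sub.real_cond_exp_intA[OF Xi A] by (simp add: set_lebesgue_integral_def)
    also have "\<dots> = (\<integral>\<omega>. indicator A \<omega> * inner h (Y \<omega>) \<partial>M)"
    proof (rule integral_cong_AE)
      show "(\<lambda>\<omega>. indicator A \<omega> * real_cond_exp M G (\<lambda>\<omega>. inner h (X \<omega>)) \<omega>) \<in> borel_measurable M"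
        using AM by simp
      show "(\<lambda>\<omega>. indicator A \<omega> * inner h (Y \<omega>)) \<in> borel_measurable M"
        using AM Yi by simp
      have "AE \<omega> in M. real_cond_exp M G (\<lambda>\<omega>. inner h (X \<omega>)) \<omega> = inner h (Y \<omega>)"
        using ce unfolding is_cond_exp_def by blast
      then show "AE \<omega> in M. indicator A \<omega> * real_cond_exp M G (\<lambda>\<omega>. inner h (X \<omega>)) \<omega> = indicator A \<omega> * inner h (Y \<omega>)"
        by eventually_elim simp
    qed
    finally show ?thesis
      using integrable_real_mult_indicator[OF AM Xi] integrable_real_mult_indicator[OF AM Yi]
      by (simp add: inner_diff_right right_diff_distrib mult.commute)
  qed
  have zero: "expectation (\<lambda>\<omega>. inner (t i \<omega>) (X \<omega> - Y \<omega>)) = 0" for i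
  proof -
    let ?A = "\<lambda>h. t i -` {h} \<inter> space M"
    have fin: "finite (t i ` space M)" and A: "?A h \<in> sets G" if "h \<in> t i ` space M" for h
      using t_simple[of i] that sp by (auto simp: simple_function_def)
    have fin: "finite (t i ` space M)" using t_simple[of i] sp by (simp add: simple_function_def)
    have "expectation (\<lambda>\<omega>. inner (t i \<omega>) (X \<omega> - Y \<omega>))
        = expectation (\<lambda>\<omega>. \<Sum>h\<in>t i ` space M. indicator (?A h) \<omega> * inner h (X \<omega> - Y \<omega>))"
    proof (rule Bochner_Integration.integral_cong[OF refl])
      fix \<omega> assume \<omega>: "\<omega> \<in> space M"
      have "(\<Sum>h\<in>t i ` space M. indicator (?A h) \<omega> * inner h (X \<omega> - Y \<omega>))
          = (\<Sum>h\<in>t i ` space M. if h = t i \<omega> then inner h (X \<omega> - Y \<omega>) else 0)"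
        using \<omega> by (intro sum.cong) (auto simp: indicator_def)
      also have "\<dots> = inner (t i \<omega>) (X \<omega> - Y \<omega>)" using fin \<omega> by simp
      finally show "inner (t i \<omega>) (X \<omega> - Y \<omega>) = (\<Sum>h\<in>t i ` space M. indicator (?A h) \<omega> * inner h (X \<omega> - Y \<omega>))" ..
    qed
    also have "\<dots> = (\<Sum>h\<in>t i ` space M. expectation (\<lambda>\<omega>. indicator (?A h) \<omega> * inner h (X \<omega> - Y \<omega>)))"
    proof (rule Bochner_Integration.integral_sum)
      fix h assume h: "h \<in> t i ` space M"
      have "?A h \<in> sets M" using A[OF h] sub by (auto simp: subalgebra_def)
      moreover have "integrable M (\<lambda>\<omega>. inner h (X \<omega> - Y \<omega>))"
        by (intro integrable_bounded_measurable bounded_measurable_inner bounded_measurable_const noise)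
      ultimately show "integrable M (\<lambda>\<omega>. indicator (?A h) \<omega> * inner h (X \<omega> - Y \<omega>))"
        using integrable_real_mult_indicator by (metis (no_types, lifting) Bochner_Integration.integrable_cong mult.commute)
    qed
    also have "\<dots> = 0" using A by (intro sum.neutral) (auto intro: test)
    finally show ?thesis .
  qed
  have "(\<lambda>i. expectation (\<lambda>\<omega>. inner (t i \<omega>) (X \<omega> - Y \<omega>))) \<longlonglongrightarrow> expectation (\<lambda>\<omega>. inner (V \<omega>) (X \<omega> - Y \<omega>))"
  proof (rule integral_dominated_convergence[where w = "\<lambda>_. K * C"])
    have sm: "strongly_measurable M (\<lambda>\<omega>. X \<omega> - Y \<omega>)" "strongly_measurable M V"
      using noise V strongly_measurable_subalgebra[OF sub] by (auto simp: bounded_measurable_def)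
    have "strongly_measurable M (t i)" for i
      unfolding strongly_measurable_def using simple_function_subalgebra[OF sub t_simple]
      by (intro exI[of _ "\<lambda>_. t i"]) auto
    then show "(\<lambda>\<omega>. inner (t i \<omega>) (X \<omega> - Y \<omega>)) \<in> borel_measurable M" for i
      by (rule borel_measurable_inner_strong[OF _ sm(1)])
    show "(\<lambda>\<omega>. inner (V \<omega>) (X \<omega> - Y \<omega>)) \<in> borel_measurable M"
      by (rule borel_measurable_inner_strong[OF sm(2,1)])
    show "AE \<omega> in M. norm (inner (t i \<omega>) (X \<omega> - Y \<omega>)) \<le> K * C" for i
      using C
    proof eventually_elim
      case (elim \<omega>)
      have "norm (inner (t i \<omega>) (X \<omega> - Y \<omega>)) \<le> norm (t i \<omega>) * norm (X \<omega> - Y \<omega>)"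
        by (simp add: Cauchy_Schwarz_ineq2)
      also have "\<dots> \<le> K * C" using elim t_le by (intro mult_mono) (auto simp: K_def)
      finally show ?case .
    qed
    show "AE \<omega> in M. (\<lambda>i. inner (t i \<omega>) (X \<omega> - Y \<omega>)) \<longlonglongrightarrow> inner (V \<omega>) (X \<omega> - Y \<omega>)"
      using K0 AE_space
    proof eventually_elim
      case (elim \<omega>)
      have "\<forall>\<^sub>F i in sequentially. norm (s i \<omega>) < K"
        by (rule order_tendstoD[OF tendsto_norm[OF s(2)[OF elim(2)]]]) (use elim K_def in auto)
      then have "\<forall>\<^sub>F i in sequentially. s i \<omega> = t i \<omega>"
        by eventually_elim (simp add: t_def)
      then have "(\<lambda>i. t i \<omega>) \<longlonglongrightarrow> V \<omega>"
        by (rule Lim_transform_eventually[OF s(2)[OF elim(2)]])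
      then show ?case by (intro tendsto_intros)
    qed
  qed simp
  then show ?thesis unfolding zero by (simp add: LIMSEQ_const_iff)
qed

section \<open>Moments of the recursion\<close>

text \<open>The recursion seen from the minimizer: \<open>v\<close> is the error of the iterate, \<open>G\<close> the true gradient and
  \<open>X\<close> its unbiased estimate. Convexity of the objective enters as
  \<open>0 \<le> inner (G n \<omega>) (v n \<omega>)\<close>.\<close>

locale bounded_stochastic_descent = prob_space M
  for M :: "'w measure" +
  fixes F :: "nat \<Rightarrow> 'w measure" and v G X :: "nat \<Rightarrow> 'w \<Rightarrow> 'h::{real_inner, complete_space}"
    and v0 :: 'h and \<gamma> R :: real
  assumes sub: "\<And>n. subalgebra M (F n)"
    and mono: "\<And>m n. m \<le> n \<Longrightarrow> subalgebra (F n) (F m)"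
    and \<gamma>_pos: "0 < \<gamma>" and R_nonneg: "0 \<le> R"
    and v_measurable: "\<And>n. strongly_measurable (F n) (v n)"
    and G_measurable: "\<And>n. strongly_measurable (F n) (G n)"
    and X_measurable: "\<And>n. strongly_measurable M (X n)"
    and G_bound: "\<And>n \<omega>. norm (G n \<omega>) \<le> R"
    and X_bound: "\<And>n. AE \<omega> in M. norm (X n \<omega>) \<le> R"
    and unbiased: "\<And>n. is_cond_exp M (F n) (X n) (G n)"
    and G_nonneg: "\<And>n \<omega>. 0 \<le> inner (G n \<omega>) (v n \<omega>)"
    and v_0: "\<And>\<omega>. \<omega> \<in> space M \<Longrightarrow> v 0 \<omega> = v0"
    and v_Suc: "\<And>n \<omega>. \<omega> \<in> space M \<Longrightarrow> v (Suc n) \<omega> = v n \<omega> - \<gamma> *\<^sub>R X n \<omega>"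
begin

lemma space_F: "space (F n) = space M"
  using sub[of n] by (simp add: subalgebra_def)

lemma v_bounded: "bounded_measurable M (F n) (v n)"
proof -
  have "AE \<omega> in M. norm (v n \<omega>) \<le> norm v0 + real n * (\<gamma> * R)"
  proof (induction n)
    case 0
    show ?case using AE_space by eventually_elim (simp add: v_0)
  next
    case (Suc n)
    show ?case using Suc X_bound[of n] AE_space
    proof eventually_elim
      case (elim \<omega>)
      have "norm (v (Suc n) \<omega>) \<le> norm (v n \<omega>) + \<gamma> * norm (X n \<omega>)"
        using norm_triangle_ineq4[of "v n \<omega>" "\<gamma> *\<^sub>R X n \<omega>"] \<gamma>_pos v_Suc[OF elim(3), of n] by simp
      also have "\<gamma> * norm (X n \<omega>) \<le> \<gamma> * R" using elim \<gamma>_pos by simp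
      finally show ?case using elim(1) by (simp add: algebra_simps)
    qed
  qed
  then show ?thesis using v_measurable unfolding bounded_measurable_def by blast
qed

lemma G_bounded: "bounded_measurable M (F n) (G n)"
  unfolding bounded_measurable_def using G_measurable G_bound by (intro conjI exI[of _ R] AE_I2)

lemma X_bounded: "bounded_measurable M M (X n)"
  using X_measurable X_bound unfolding bounded_measurable_def by blast

lemma bounded_measurable_mono: "m \<le> n \<Longrightarrow> bounded_measurable M (F m) Z \<Longrightarrow> bounded_measurable M (F n) Z"
  by (rule bounded_measurable_subalgebra[OF mono])

lemma bounded_measurable_M: "bounded_measurable M (F m) Z \<Longrightarrow> bounded_measurable M M Z"
  by (rule bounded_measurable_subalgebra[OF sub])

lemmas bounded_intros = bounded_measurable_const bounded_measurable_add bounded_measurable_diff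
  bounded_measurable_scaleR bounded_measurable_inner bounded_measurable_sum

definition noise :: "nat \<Rightarrow> 'w \<Rightarrow> 'h" where
  "noise n \<omega> = X n \<omega> - G n \<omega>"

definition noise_sum :: "nat \<Rightarrow> 'w \<Rightarrow> 'h" where
  "noise_sum n \<omega> = (\<Sum>k<n. noise k \<omega>)"

lemma noise_bounded: "bounded_measurable M M (noise n)"
  unfolding noise_def[abs_def] by (intro bounded_intros X_bounded bounded_measurable_M[OF G_bounded])

lemma AE_norm_noise_le: "AE \<omega> in M. norm (noise n \<omega>) \<le> 2 * R"
  using X_bound[of n]
proof eventually_elim
  case (elim \<omega>)
  show ?case using norm_triangle_ineq4[of "X n \<omega>" "G n \<omega>"] elim G_bound[of n \<omega>]
    unfolding noise_def by linarith
qed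

lemma expectation_inner_noise:
  assumes "bounded_measurable M (F n) V"
  shows "expectation (\<lambda>\<omega>. inner (V \<omega>) (noise n \<omega>)) = 0"
  unfolding noise_def
  by (rule expectation_inner_noise_eq_0[OF sub unbiased assms X_bounded G_bounded])

lemma sum_X:
  assumes "\<omega> \<in> space M"
  shows "(\<Sum>k<n. X k \<omega>) = (1 / \<gamma>) *\<^sub>R (v0 - v n \<omega>)"
proof (induction n)
  case 0
  show ?case using assms by (simp add: v_0)
next
  case (Suc n)
  have "X n \<omega> = (1 / \<gamma>) *\<^sub>R (v n \<omega> - v (Suc n) \<omega>)"
    using v_Suc[OF assms, of n] \<gamma>_pos by simp
  then have "(\<Sum>k<Suc n. X k \<omega>) = (1 / \<gamma>) *\<^sub>R ((v0 - v n \<omega>) + (v n \<omega> - v (Suc n) \<omega>))"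
    unfolding scaleR_add_right using Suc by simp
  then show ?case by simp
qed

lemma noise_sum_eq:
  assumes "\<omega> \<in> space M"
  shows "noise_sum n \<omega> = (1 / \<gamma>) *\<^sub>R (v0 - v n \<omega>) - (\<Sum>k<n. G k \<omega>)"
  using sum_X[OF assms] by (simp add: noise_sum_def noise_def sum_subtractf)

text \<open>Each \<open>X k\<close> is assumed measurable only for \<open>M\<close>; the recursion expresses the sum through \<open>v n\<close>,
  which is measurable for \<open>F n\<close>.\<close>

lemma noise_sum_bounded: "bounded_measurable M (F n) (noise_sum n)"
proof -
  have "bounded_measurable M (F n) (\<lambda>\<omega>. (1 / \<gamma>) *\<^sub>R (v0 - v n \<omega>) - (\<Sum>k<n. G k \<omega>))"
    by (intro bounded_intros v_bounded bounded_measurable_mono[OF _ G_bounded]) simp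
  then show ?thesis
    by (rule bounded_measurable_cong[THEN iffD1, rotated 2]) (simp_all add: noise_sum_eq space_F)
qed

lemma integrable_inner:
  "bounded_measurable M M Y \<Longrightarrow> bounded_measurable M M Z \<Longrightarrow> integrable M (\<lambda>\<omega>. inner (Y \<omega>) (Z \<omega>))"
  by (intro integrable_bounded_measurable bounded_measurable_inner)

lemma expectation_noise_sum_square:
  "expectation (\<lambda>\<omega>. (norm (noise_sum n \<omega>))\<^sup>2) \<le> 4 * R\<^sup>2 * real n"
proof (induction n)
  case 0
  show ?case by (simp add: noise_sum_def)
next
  case (Suc n)
  let ?S = "noise_sum n" and ?e = "noise n"
  have S: "bounded_measurable M M ?S" by (rule bounded_measurable_M[OF noise_sum_bounded])
  have "expectation (\<lambda>\<omega>. (norm (noise_sum (Suc n) \<omega>))\<^sup>2)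
      = expectation (\<lambda>\<omega>. inner (?S \<omega>) (?S \<omega>) + 2 * inner (?S \<omega>) (?e \<omega>) + inner (?e \<omega>) (?e \<omega>))"
    by (rule Bochner_Integration.integral_cong[OF refl])
      (simp add: noise_sum_def power2_norm_eq_inner inner_add_left inner_add_right
        inner_commute[of "noise n _" "sum _ _"])
  also have "\<dots> = expectation (\<lambda>\<omega>. inner (?S \<omega>) (?S \<omega>)) + 2 * expectation (\<lambda>\<omega>. inner (?S \<omega>) (?e \<omega>))
      + expectation (\<lambda>\<omega>. inner (?e \<omega>) (?e \<omega>))"
    using integrable_inner[OF S S] integrable_inner[OF S noise_bounded] integrable_inner[OF noise_bounded noise_bounded]
    by simp
  also have "expectation (\<lambda>\<omega>. inner (?e \<omega>) (?e \<omega>)) \<le> expectation (\<lambda>\<omega>. 4 * R\<^sup>2)"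
  proof (rule integral_mono_AE[OF integrable_inner[OF noise_bounded noise_bounded]])
    show "AE \<omega> in M. inner (?e \<omega>) (?e \<omega>) \<le> 4 * R\<^sup>2"
      using AE_norm_noise_le[of n]
    proof eventually_elim
      case (elim \<omega>)
      then have "(norm (?e \<omega>))\<^sup>2 \<le> (2 * R)\<^sup>2" by (intro power_mono) auto
      then show ?case by (simp add: power2_norm_eq_inner power_mult_distrib)
    qed
  qed simp
  finally show ?case
    using Suc expectation_inner_noise[OF noise_sum_bounded] prob_space by (simp add: power2_norm_eq_inner algebra_simps)
qed

definition potential :: "nat \<Rightarrow> 'w \<Rightarrow> real" where
  "potential n \<omega> = (norm (v n \<omega>))\<^sup>2 + 2 * \<gamma> * (\<Sum>k<n. inner (G k \<omega>) (v k \<omega>))"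

lemma potential_bounded: "bounded_measurable M (F n) (potential n)"
  unfolding potential_def[abs_def] power2_norm_eq_inner real_scaleR_def[symmetric]
  by (intro bounded_intros v_bounded bounded_measurable_mono[OF _ G_bounded] bounded_measurable_mono[OF _ v_bounded]) simp_all

lemma norm_square_le_potential: "(norm (v n \<omega>))\<^sup>2 \<le> potential n \<omega>"
  using \<gamma>_pos by (simp add: potential_def sum_nonneg G_nonneg)

lemma potential_nonneg: "0 \<le> potential n \<omega>"
  using norm_square_le_potential[of n \<omega>] by (meson order_trans zero_le_power2)

lemma potential_Suc_le:
  "AE \<omega> in M. potential (Suc n) \<omega> \<le> potential n \<omega> + \<gamma>\<^sup>2 * R\<^sup>2 - 2 * \<gamma> * inner (v n \<omega>) (noise n \<omega>)"
  using X_bound[of n] AE_space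
proof eventually_elim
  case (elim \<omega>)
  have "potential (Suc n) \<omega> = potential n \<omega> + \<gamma>\<^sup>2 * (norm (X n \<omega>))\<^sup>2 - 2 * \<gamma> * inner (v n \<omega>) (noise n \<omega>)"
  proof -
    have "(norm (v (Suc n) \<omega>))\<^sup>2 = (norm (v n \<omega>))\<^sup>2 - 2 * \<gamma> * inner (v n \<omega>) (X n \<omega>) + \<gamma>\<^sup>2 * (norm (X n \<omega>))\<^sup>2"
      unfolding v_Suc[OF elim(2)] power2_norm_eq_inner power2_eq_square[of \<gamma>]
      by (simp add: inner_diff_left inner_diff_right inner_commute[of "X n \<omega>" "v n \<omega>"] right_diff_distrib)
    then show ?thesis
      by (simp add: potential_def noise_def inner_diff_right inner_commute[of "G n \<omega>" "v n \<omega>"] distrib_left right_diff_distrib)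
  qed
  moreover have "\<gamma>\<^sup>2 * (norm (X n \<omega>))\<^sup>2 \<le> \<gamma>\<^sup>2 * R\<^sup>2"
    using elim by (intro mult_left_mono power_mono) auto
  ultimately show ?case by linarith
qed

lemma expectation_potential: "expectation (potential n) \<le> (norm v0)\<^sup>2 + real n * (\<gamma>\<^sup>2 * R\<^sup>2)"
proof (induction n)
  case 0
  have "expectation (potential 0) = expectation (\<lambda>_. (norm v0)\<^sup>2)"
    by (rule Bochner_Integration.integral_cong) (simp_all add: potential_def v_0)
  then show ?case using prob_space by simp
next
  case (Suc n)
  note i = integrable_bounded_measurable[OF bounded_measurable_M[OF potential_bounded]]
    integrable_inner[OF bounded_measurable_M[OF v_bounded] noise_bounded]
  have "expectation (potential (Suc n))
      \<le> expectation (\<lambda>\<omega>. potential n \<omega> + \<gamma>\<^sup>2 * R\<^sup>2 - 2 * \<gamma> * inner (v n \<omega>) (noise n \<omega>))"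
    by (rule integral_mono_AE[OF _ _ potential_Suc_le]) (use i in simp_all)
  also have "\<dots> = expectation (potential n) + \<gamma>\<^sup>2 * R\<^sup>2"
    using i expectation_inner_noise[OF v_bounded] prob_space by simp
  finally show ?case using Suc by (simp add: algebra_simps)
qed

text \<open>The centered term of one step is at most \<open>4 * \<gamma> * R * norm (v n \<omega>)\<close> in absolute value, so its
  square is at most \<open>16 * (\<gamma>\<^sup>2 * R\<^sup>2)\<close> times the potential; together with the cross
  term of the drift this makes the factor 18.\<close>

lemma expectation_potential_square:
  "expectation (\<lambda>\<omega>. (potential n \<omega>)\<^sup>2)
    \<le> (norm v0) ^ 4 + 18 * (\<gamma>\<^sup>2 * R\<^sup>2) * real n * ((norm v0)\<^sup>2 + real n * (\<gamma>\<^sup>2 * R\<^sup>2))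
      + real n * (\<gamma>\<^sup>2 * R\<^sup>2)\<^sup>2"
proof (induction n)
  case 0
  have "expectation (\<lambda>\<omega>. (potential 0 \<omega>)\<^sup>2) = expectation (\<lambda>_. (norm v0) ^ 4)"
    by (rule Bochner_Integration.integral_cong) (simp_all add: potential_def v_0)
  then show ?case using prob_space by simp
next
  case (Suc n)
  define g where "g = \<gamma>\<^sup>2 * R\<^sup>2"
  define D where "D = (norm v0)\<^sup>2"
  have g: "0 \<le> g" by (simp add: g_def)
  let ?U = "potential n" and ?e = "noise n"
  define V where "V \<omega> = (?U \<omega> + g) *\<^sub>R v n \<omega>" for \<omega>
  have V: "bounded_measurable M (F n) V"
    unfolding V_def[abs_def] by (intro bounded_intros potential_bounded v_bounded)
  have U: "bounded_measurable M M (potential m)" for m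
    by (rule bounded_measurable_M[OF potential_bounded])
  have square: "integrable M (\<lambda>\<omega>. (potential m \<omega>)\<^sup>2)" for m
    using integrable_inner[OF U U] by (simp add: power2_eq_square)
  note i = integrable_bounded_measurable[OF U] square
    integrable_inner[OF bounded_measurable_M[OF V] noise_bounded]
  have "AE \<omega> in M. (potential (Suc n) \<omega>)\<^sup>2
      \<le> (?U \<omega>)\<^sup>2 + 18 * g * ?U \<omega> + g\<^sup>2 - 4 * \<gamma> * inner (V \<omega>) (?e \<omega>)"
    using potential_Suc_le[of n] AE_norm_noise_le[of n]
  proof eventually_elim
    case (elim \<omega>)
    define w where "w = inner (v n \<omega>) (?e \<omega>)"
    have "\<bar>w\<bar> \<le> norm (v n \<omega>) * norm (?e \<omega>)" by (simp add: w_def Cauchy_Schwarz_ineq2)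
    also have "\<dots> \<le> norm (v n \<omega>) * (2 * R)" using elim by (intro mult_left_mono) auto
    finally have "\<bar>w\<bar>\<^sup>2 \<le> (norm (v n \<omega>) * (2 * R))\<^sup>2" by (intro power_mono) auto
    then have "w\<^sup>2 \<le> 4 * R\<^sup>2 * (norm (v n \<omega>))\<^sup>2" by (simp add: power_mult_distrib mult_ac)
    also have "\<dots> \<le> 4 * R\<^sup>2 * ?U \<omega>"
      using norm_square_le_potential by (intro mult_left_mono) auto
    finally have "4 * \<gamma>\<^sup>2 * w\<^sup>2 \<le> 4 * \<gamma>\<^sup>2 * (4 * R\<^sup>2 * ?U \<omega>)" by (intro mult_left_mono) auto
    then have w2: "4 * \<gamma>\<^sup>2 * w\<^sup>2 \<le> 16 * g * ?U \<omega>" by (simp add: g_def mult_ac)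
    have "(potential (Suc n) \<omega>)\<^sup>2 \<le> (?U \<omega> + g - 2 * \<gamma> * w)\<^sup>2"
      using elim(1) potential_nonneg by (intro power_mono) (auto simp: g_def w_def)
    also have "\<dots> = (?U \<omega>)\<^sup>2 + 2 * g * ?U \<omega> + g\<^sup>2 - 4 * \<gamma> * ((?U \<omega> + g) * w) + 4 * \<gamma>\<^sup>2 * w\<^sup>2"
      by (simp add: power2_eq_square algebra_simps)
    finally show ?case using w2 by (simp add: V_def w_def)
  qed
  then have "expectation (\<lambda>\<omega>. (potential (Suc n) \<omega>)\<^sup>2)
      \<le> expectation (\<lambda>\<omega>. (?U \<omega>)\<^sup>2 + 18 * g * ?U \<omega> + g\<^sup>2 - 4 * \<gamma> * inner (V \<omega>) (?e \<omega>))"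
    by (rule integral_mono_AE[rotated 2]) (use i in simp_all)
  also have "\<dots> = expectation (\<lambda>\<omega>. (?U \<omega>)\<^sup>2) + 18 * g * expectation ?U + g\<^sup>2"
    using i expectation_inner_noise[OF V] prob_space by simp
  also have "18 * g * expectation ?U \<le> 18 * g * (D + real n * g)"
    using expectation_potential[of n] g by (intro mult_left_mono) (auto simp: D_def g_def)
  also have "expectation (\<lambda>\<omega>. (?U \<omega>)\<^sup>2) \<le> (norm v0) ^ 4 + 18 * g * real n * (D + real n * g) + real n * g\<^sup>2"
    using Suc by (simp add: D_def g_def)
  finally have "expectation (\<lambda>\<omega>. (potential (Suc n) \<omega>)\<^sup>2)
      \<le> (norm v0) ^ 4 + 18 * g * real (Suc n) * (D + real n * g) + real (Suc n) * g\<^sup>2"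
    by (simp add: algebra_simps)
  also have "18 * g * real (Suc n) * (D + real n * g) \<le> 18 * g * real (Suc n) * (D + real (Suc n) * g)"
    using g by (intro mult_left_mono add_left_mono mult_right_mono) auto
  finally show ?case by (simp add: D_def g_def)
qed

end

section \<open>The averaged iterate\<close>

lemma sum3_square_le:
  fixes a b c :: real
  shows "(a + b + c)\<^sup>2 \<le> 3 * (a\<^sup>2 + b\<^sup>2 + c\<^sup>2)"
  using zero_le_power2[of "a - b"] zero_le_power2[of "b - c"] zero_le_power2[of "a - c"]
  by (simp add: power2_eq_square algebra_simps)

text \<open>The polynomial \<open>300 * D ^ 4 + 1362 * D\<^sup>2 + 12 * D + 375\<close> bounds the second moment of the
  deviation in units of \<open>R\<^sup>2 / N\<close>, with \<open>D = R * norm v0\<close>.\<close>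

lemma averaged_bound_polynomials:
  fixes D :: real
  assumes "0 \<le> D"
  shows "3 / 2 * (300 * D ^ 4 + 1362 * D\<^sup>2 + 12 * D + 375) \<le> (5 * D + 15) ^ 4"
    and "300 * D ^ 4 + 1362 * D\<^sup>2 + 12 * D + 375 \<le> (6 * D + 21) ^ 4"
proof -
  have p5: "(5 * D + 15) ^ 4 = 625 * D ^ 4 + 7500 * D ^ 3 + 33750 * D\<^sup>2 + 67500 * D + 50625"
    by (simp add: power4_eq_xxxx power3_eq_cube power2_eq_square algebra_simps)
  have p6: "(6 * D + 21) ^ 4 = 1296 * D ^ 4 + 18144 * D ^ 3 + 95256 * D\<^sup>2 + 222264 * D + 194481"
    by (simp add: power4_eq_xxxx power3_eq_cube power2_eq_square algebra_simps)
  have nonneg: "0 \<le> D ^ 4" "0 \<le> D ^ 3" "0 \<le> D\<^sup>2" using assms by simp_all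
  show "3 / 2 * (300 * D ^ 4 + 1362 * D\<^sup>2 + 12 * D + 375) \<le> (5 * D + 15) ^ 4"
    unfolding p5 distrib_left using nonneg assms by linarith
  show "300 * D ^ 4 + 1362 * D\<^sup>2 + 12 * D + 375 \<le> (6 * D + 21) ^ 4"
    unfolding p6 using nonneg assms by linarith
qed

locale averaged_descent = bounded_stochastic_descent M F v G X v0 \<gamma> R
  for M :: "'w measure" and F :: "nat \<Rightarrow> 'w measure"
    and v G X :: "nat \<Rightarrow> 'w \<Rightarrow> 'h::{real_inner, complete_space}" and v0 :: 'h and \<gamma> R :: real +
  fixes N :: nat
  assumes N_pos: "0 < N" and R_pos: "0 < R" and step_size: "\<gamma> = 1 / (2 * R\<^sup>2 * sqrt (real N))"
begin

text \<open>The quantity whose square bounds both errors of the averaged iterate.\<close>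

definition deviation :: "'w \<Rightarrow> real" where
  "deviation \<omega> = norm ((1 / real N) *\<^sub>R (\<Sum>k<N. G k \<omega>))
     + 10 * R * ((\<Sum>k<N. inner (G k \<omega>) (v k \<omega>)) / real N)"

lemma deviation_nonneg: "0 \<le> deviation \<omega>"
  using R_pos by (simp add: deviation_def sum_nonneg G_nonneg)

text \<open>The average gradient is read off from the recursion and the average gap from the
  potential. The term linear in \<open>norm (v N \<omega>)\<close> left by the former is compensated by the
  squared norm that the potential contains in addition to the gaps.\<close>

lemma deviation_le:
  assumes \<omega>: "\<omega> \<in> space M"
  shows "deviation \<omega> \<le> R / sqrt (real N) *
    ((2 * (R * norm v0) + 1) + 10 * R\<^sup>2 * potential N \<omega> + norm (noise_sum N \<omega>) / (R * sqrt (real N)))"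
proof -
  define s where "s = sqrt (real N)"
  have s: "0 < s" "real N = s * s" using N_pos by (simp_all add: s_def)
  have \<gamma>N: "1 / (\<gamma> * N) = 2 * R\<^sup>2 / s"
    using s R_pos by (simp add: step_size s_def[symmetric])
  define d where "d = norm (v N \<omega>)"
  have "norm ((1 / real N) *\<^sub>R (\<Sum>k<N. G k \<omega>)) = norm ((1 / (\<gamma> * N)) *\<^sub>R (v0 - v N \<omega>) - (1 / real N) *\<^sub>R noise_sum N \<omega>)"
    unfolding noise_sum_eq[OF \<omega>] scaleR_diff_right by (simp add: mult.commute)
  also have "\<dots> \<le> 2 * R\<^sup>2 / s * norm (v0 - v N \<omega>) + norm (noise_sum N \<omega>) / N"
    unfolding \<gamma>N using norm_triangle_ineq4[of "(2 * R\<^sup>2 / s) *\<^sub>R (v0 - v N \<omega>)" "(1 / real N) *\<^sub>R noise_sum N \<omega>"] s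
    by simp
  also have "2 * R\<^sup>2 / s * norm (v0 - v N \<omega>) \<le> 2 * R\<^sup>2 / s * (norm v0 + d)"
    unfolding d_def using s by (intro mult_left_mono norm_triangle_ineq4) simp
  also have "2 * R\<^sup>2 / s * (norm v0 + d) + norm (noise_sum N \<omega>) / N
      = R / s * (2 * (R * norm v0) + 2 * (R * d) + norm (noise_sum N \<omega>) / (R * s))"
    using s R_pos by (simp add: field_simps power2_eq_square)
  finally have p: "norm ((1 / real N) *\<^sub>R (\<Sum>k<N. G k \<omega>))
      \<le> R / s * (2 * (R * norm v0) + 2 * (R * d) + norm (noise_sum N \<omega>) / (R * s))"
    by simp
  have "(\<Sum>k<N. inner (G k \<omega>) (v k \<omega>)) / real N = (potential N \<omega> - d\<^sup>2) / (2 * (\<gamma> * N))"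
    using \<gamma>_pos N_pos by (simp add: potential_def d_def field_simps)
  also have "\<dots> = (potential N \<omega> - d\<^sup>2) / 2 * (1 / (\<gamma> * N))" by simp
  also have "\<dots> = R / s * (R * (potential N \<omega> - d\<^sup>2))"
    unfolding \<gamma>N by (simp add: power2_eq_square)
  finally have mean: "(\<Sum>k<N. inner (G k \<omega>) (v k \<omega>)) / real N = R / s * (R * (potential N \<omega> - d\<^sup>2))" .
  have a: "10 * R * ((\<Sum>k<N. inner (G k \<omega>) (v k \<omega>)) / real N)
      = R / s * (10 * R\<^sup>2 * potential N \<omega> - 10 * (R * d)\<^sup>2)"
    unfolding mean by (simp add: power2_eq_square algebra_simps)
  have "2 * (R * d) \<le> 1 + 10 * (R * d)\<^sup>2"
  proof -
    have "2 * (R * d) \<le> (R * d)\<^sup>2 + 1"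
      using zero_le_power2[of "R * d - 1"] by (simp add: power2_diff)
    then show ?thesis using zero_le_power2[of "R * d"] by linarith
  qed
  then have "R / s * (2 * (R * norm v0) + 2 * (R * d) + norm (noise_sum N \<omega>) / (R * s)
        + (10 * R\<^sup>2 * potential N \<omega> - 10 * (R * d)\<^sup>2))
      \<le> R / s * ((2 * (R * norm v0) + 1) + 10 * R\<^sup>2 * potential N \<omega> + norm (noise_sum N \<omega>) / (R * s))"
    using s R_pos by (intro mult_left_mono) auto
  then show ?thesis
    using p unfolding deviation_def a s_def[symmetric] by (simp only: distrib_left)
qed

lemma expectation_deviation_square:
  "integrable M (\<lambda>\<omega>. (deviation \<omega>)\<^sup>2)"
  "expectation (\<lambda>\<omega>. (deviation \<omega>)\<^sup>2) \<le> R\<^sup>2 / real N *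
     (300 * (R * norm v0) ^ 4 + 1362 * (R * norm v0)\<^sup>2 + 12 * (R * norm v0) + 375)"
proof -
  define D where "D = R * norm v0"
  define B where "B \<omega> = R\<^sup>2 / real N * (3 * ((2 * D + 1)\<^sup>2 + 100 * R ^ 4 * (potential N \<omega>)\<^sup>2
    + (norm (noise_sum N \<omega>))\<^sup>2 / (R\<^sup>2 * real N)))" for \<omega>
  have iU: "integrable M (\<lambda>\<omega>. (potential N \<omega>)\<^sup>2)"
    using integrable_inner[OF bounded_measurable_M[OF potential_bounded] bounded_measurable_M[OF potential_bounded], of N N]
    by (simp add: power2_eq_square)
  have iS: "integrable M (\<lambda>\<omega>. (norm (noise_sum N \<omega>))\<^sup>2)"
    using integrable_inner[OF bounded_measurable_M[OF noise_sum_bounded] bounded_measurable_M[OF noise_sum_bounded], of N N]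
    by (simp add: power2_norm_eq_inner)
  have iB: "integrable M B" unfolding B_def[abs_def] using iU iS by simp
  have le: "(deviation \<omega>)\<^sup>2 \<le> B \<omega>" if "\<omega> \<in> space M" for \<omega>
  proof -
    have "(deviation \<omega>)\<^sup>2 \<le> (R / sqrt (real N) * ((2 * D + 1) + 10 * R\<^sup>2 * potential N \<omega>
        + norm (noise_sum N \<omega>) / (R * sqrt (real N))))\<^sup>2"
      using deviation_le[OF that] deviation_nonneg by (intro power_mono) (auto simp: D_def)
    also have "\<dots> = R\<^sup>2 / real N * ((2 * D + 1) + 10 * R\<^sup>2 * potential N \<omega>
        + norm (noise_sum N \<omega>) / (R * sqrt (real N)))\<^sup>2"
      by (simp add: power_mult_distrib power_divide)
    also have "\<dots> \<le> R\<^sup>2 / real N * (3 * ((2 * D + 1)\<^sup>2 + (10 * R\<^sup>2 * potential N \<omega>)\<^sup>2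
        + (norm (noise_sum N \<omega>) / (R * sqrt (real N)))\<^sup>2))"
      by (intro mult_left_mono sum3_square_le) simp
    also have "\<dots> = B \<omega>"
      by (simp add: B_def power_mult_distrib power_divide flip: power_mult)
    finally show ?thesis .
  qed
  have "(\<lambda>\<omega>. deviation \<omega>) \<in> borel_measurable M"
  proof -
    have "strongly_measurable M (G k)" "strongly_measurable M (v k)" for k
      using strongly_measurable_subalgebra[OF sub] G_measurable v_measurable by blast+
    then show ?thesis unfolding deviation_def
      by (intro borel_measurable_add borel_measurable_times borel_measurable_divide borel_measurable_const
          borel_measurable_sum borel_measurable_inner_strong borel_measurable_norm_strong
          strongly_measurable_scaleR strongly_measurable_sum)
  qed
  then show i: "integrable M (\<lambda>\<omega>. (deviation \<omega>)\<^sup>2)"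
    by (intro Bochner_Integration.integrable_bound[OF iB] borel_measurable_power AE_I2) (use le in force)+
  have "expectation (\<lambda>\<omega>. (deviation \<omega>)\<^sup>2) \<le> expectation B"
    using i iB le by (rule integral_mono)
  also have "\<dots> = R\<^sup>2 / real N * (3 * ((2 * D + 1)\<^sup>2 + 100 * R ^ 4 * expectation (\<lambda>\<omega>. (potential N \<omega>)\<^sup>2)
      + expectation (\<lambda>\<omega>. (norm (noise_sum N \<omega>))\<^sup>2) / (R\<^sup>2 * real N)))"
    unfolding B_def using iU iS prob_space by simp
  also have "\<dots> \<le> R\<^sup>2 / real N * (3 * ((2 * D + 1)\<^sup>2 + 100 * (D ^ 4 + 9 / 2 * D\<^sup>2 + 19 / 16) + 4))"
  proof -
    have g: "\<gamma>\<^sup>2 * R\<^sup>2 * real N = 1 / (4 * R\<^sup>2)"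
      using N_pos R_pos by (simp add: step_size power_divide power_mult_distrib field_simps)
    have "18 * (\<gamma>\<^sup>2 * R\<^sup>2) * real N * ((norm v0)\<^sup>2 + real N * (\<gamma>\<^sup>2 * R\<^sup>2))
        = 18 * (\<gamma>\<^sup>2 * R\<^sup>2 * real N) * ((norm v0)\<^sup>2 + \<gamma>\<^sup>2 * R\<^sup>2 * real N)" by (simp add: mult_ac)
    moreover have "real N * (\<gamma>\<^sup>2 * R\<^sup>2)\<^sup>2 \<le> (\<gamma>\<^sup>2 * R\<^sup>2 * real N)\<^sup>2"
    proof -
      have "real N * (\<gamma>\<^sup>2 * R\<^sup>2)\<^sup>2 \<le> real N * (real N * (\<gamma>\<^sup>2 * R\<^sup>2)\<^sup>2)"
        using N_pos by (intro mult_left_mono) (simp_all add: mult_le_cancel_right1)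
      then show ?thesis by (simp add: power2_eq_square mult_ac)
    qed
    ultimately have "expectation (\<lambda>\<omega>. (potential N \<omega>)\<^sup>2)
        \<le> (norm v0) ^ 4 + 18 * (1 / (4 * R\<^sup>2)) * ((norm v0)\<^sup>2 + 1 / (4 * R\<^sup>2)) + (1 / (4 * R\<^sup>2))\<^sup>2"
      using expectation_potential_square[of N] unfolding g by linarith
    then have "R ^ 4 * expectation (\<lambda>\<omega>. (potential N \<omega>)\<^sup>2)
        \<le> R ^ 4 * ((norm v0) ^ 4 + 18 * (1 / (4 * R\<^sup>2)) * ((norm v0)\<^sup>2 + 1 / (4 * R\<^sup>2)) + (1 / (4 * R\<^sup>2))\<^sup>2)"
      by (intro mult_left_mono) auto
    also have "\<dots> = D ^ 4 + 9 / 2 * D\<^sup>2 + 19 / 16"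
      using R_pos by (simp add: D_def power_mult_distrib power2_eq_square power4_eq_xxxx field_simps)
    finally have U: "100 * R ^ 4 * expectation (\<lambda>\<omega>. (potential N \<omega>)\<^sup>2) \<le> 100 * (D ^ 4 + 9 / 2 * D\<^sup>2 + 19 / 16)"
      by simp
    have S: "expectation (\<lambda>\<omega>. (norm (noise_sum N \<omega>))\<^sup>2) / (R\<^sup>2 * real N) \<le> 4"
      using expectation_noise_sum_square[of N] N_pos R_pos by (simp add: field_simps)
    show ?thesis using U S by (intro mult_left_mono add_mono) auto
  qed
  also have "\<dots> \<le> R\<^sup>2 / real N * (300 * D ^ 4 + 1362 * D\<^sup>2 + 12 * D + 375)"
    by (intro mult_left_mono) (simp_all add: power2_eq_square algebra_simps)
  finally show "expectation (\<lambda>\<omega>. (deviation \<omega>)\<^sup>2) \<le> R\<^sup>2 / real N *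
     (300 * (R * norm v0) ^ 4 + 1362 * (R * norm v0)\<^sup>2 + 12 * (R * norm v0) + 375)"
    by (simp add: D_def)
qed

end

theorem proposition10:
  fixes M :: "'w measure"
    and F :: "nat \<Rightarrow> 'w measure"
    and f :: "'h::{real_inner, complete_space} \<Rightarrow> real"
    and fn :: "nat \<Rightarrow> 'w \<Rightarrow> 'h \<Rightarrow> real"
    and \<theta> :: "nat \<Rightarrow> 'w \<Rightarrow> 'h"
    and \<theta>\<^sub>0 \<theta>opt :: 'h
    and \<gamma> :: "nat \<Rightarrow> real"
    and R \<mu> :: real
    and N :: nat
    and avg :: "'w \<Rightarrow> 'h"
  assumes prob: "prob_space M"
    and filt: "filtration (space M) F" "\<forall>n. subalgebra M (F n)"
    and F0_trivial: "\<forall>A\<in>sets (F 0). measure M A = 0 \<or> measure M A = 1"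
    and R_pos: "R > 0"
    and fn_diff: "\<forall>n\<ge>1. \<forall>\<omega>\<in>space M. \<forall>x. fn n \<omega> differentiable (at x)"
    and A1: "convex_on UNIV f" "three_times_differentiable f"
    and A2: "\<forall>x y t. let \<phi> = (\<lambda>s. f (x + s *\<^sub>R (y - x)))
               in \<bar>(deriv ^^ 3) \<phi> t\<bar> \<le> R * norm (x - y) * (deriv ^^ 2) \<phi> t"
    and A3: "\<forall>x. f \<theta>opt \<le> f x"
    and A4: "\<forall>x. norm (gradient f x) \<le> R"
            "\<forall>x. \<forall>n\<ge>1. AE \<omega> in M. norm (gradient (fn n \<omega>) x) \<le> R"
    and A5: "\<forall>n\<ge>1. \<forall>x. (\<lambda>\<omega>. fn n \<omega> x) \<in> borel_measurable (F n)"
    and A6: "\<forall>n\<ge>1. is_cond_exp M (F (n - 1))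
               (\<lambda>\<omega>. gradient (fn n \<omega>) (\<theta> (n - 1) \<omega>)) (\<lambda>\<omega>. gradient f (\<theta> (n - 1) \<omega>))"
    and init: "\<forall>\<omega>\<in>space M. \<theta> 0 \<omega> = \<theta>\<^sub>0"
    and A7: "\<forall>n\<ge>1. \<forall>\<omega>\<in>space M.
               \<theta> n \<omega> = \<theta> (n - 1) \<omega> - \<gamma> n *\<^sub>R gradient (fn n \<omega>) (\<theta> (n - 1) \<omega>)"
    and N: "N \<ge> 1"
    and step: "\<forall>n\<ge>1. \<gamma> n = 1 / (2 * R\<^sup>2 * sqrt (real N))"
    and \<mu>: "\<mu> = lowest_eigenvalue (hessian f \<theta>opt)" "\<mu> > 0"
    and avg: "avg = (\<lambda>\<omega>. (1 / real N) *\<^sub>R (\<Sum>k=0..N-1. \<theta> k \<omega>))"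
  shows "integrable M (\<lambda>\<omega>. f (avg \<omega>)) \<and>
         (\<integral>\<omega>. f (avg \<omega>) \<partial>M) - f \<theta>opt
           \<le> R\<^sup>2 / (real N * \<mu>) * (5 * R * norm (\<theta>\<^sub>0 - \<theta>opt) + 15) ^ 4 \<and>
         integrable M (\<lambda>\<omega>. (norm (avg \<omega> - \<theta>opt))\<^sup>2) \<and>
         (\<integral>\<omega>. (norm (avg \<omega> - \<theta>opt))\<^sup>2 \<partial>M)
           \<le> R\<^sup>2 / (real N * \<mu>\<^sup>2) * (6 * R * norm (\<theta>\<^sub>0 - \<theta>opt) + 21) ^ 4"
proof -
  interpret prob_space M by (rule prob)
  interpret self_concordant_minimum f R \<theta>opt \<mu>
  proof
    show "three_times_differentiable f" "0 < R" "0 < \<mu>"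
      using A1 R_pos \<mu> by auto
    show "let \<phi> = \<lambda>s. f (x + s *\<^sub>R (y - x))
          in \<bar>(deriv ^^ 3) \<phi> t\<bar> \<le> R * norm (x - y) * (deriv ^^ 2) \<phi> t" for x y t
      using A2 by blast
    show "f \<theta>opt \<le> f x" for x using A3 by blast
    then interpret gsc: generalized_self_concordant f R
      using A1 A2 R_pos by unfold_locales auto
    show "\<mu> * (norm h)\<^sup>2 \<le> gsc.curvature \<theta>opt h" for h
    proof (cases "h = 0")
      case False
      define u where "u = (1 / norm h) *\<^sub>R h"
      have u: "norm u = 1" "h = norm h *\<^sub>R u" using False by (simp_all add: u_def)
      have "bdd_below ((\<lambda>h. inner h (hessian f \<theta>opt h)) ` {h. norm h = 1})"
        using gsc.curvature_nonneg by (intro bdd_belowI2[of _ 0]) (simp add: gsc.curvature_def inner_commute)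
      then have "\<mu> \<le> gsc.curvature \<theta>opt u"
        unfolding \<mu>(1) lowest_eigenvalue_def gsc.curvature_def inner_commute[of _ u]
        by (rule cINF_lower) (simp add: u(1))
      then have "(norm h)\<^sup>2 * \<mu> \<le> (norm h)\<^sup>2 * gsc.curvature \<theta>opt u"
        by (rule mult_left_mono) simp
      also have "\<dots> = gsc.curvature \<theta>opt (norm h *\<^sub>R u)" by (simp add: gsc.curvature_scaleR)
      finally show ?thesis unfolding u(2)[symmetric] by (simp add: mult.commute)
    qed (simp add: gsc.curvature_def)
  qed
  have sub: "subalgebra M (F n)" for n using filt(2) by blast
  have space_F: "space (F n) = space M" for n using sub[of n] by (simp add: subalgebra_def)
  have mono: "subalgebra (F n) (F m)" if "m \<le> n" for m n
    using filt(1) that unfolding filtration_def subalgebra_def by auto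
  define X where "X n \<omega> = gradient (fn (Suc n) \<omega>) (\<theta> n \<omega>)" for n \<omega>
  have unbiased: "is_cond_exp M (F n) (X n) (\<lambda>\<omega>. gradient f (\<theta> n \<omega>))" for n
    using A6[rule_format, of "Suc n"] by (simp add: X_def[abs_def])
  have recursion: "\<theta> (Suc n) \<omega> = \<theta> n \<omega> - \<gamma> 1 *\<^sub>R X n \<omega>" if "\<omega> \<in> space M" for n \<omega>
    using A7[rule_format, of "Suc n" \<omega>] that step by (simp add: X_def)
  have diff: "fn (Suc n) \<omega> differentiable (at x)" if "\<omega> \<in> space M" for n \<omega> x
    using fn_diff that by simp
  have fn_meas: "(\<lambda>\<omega>. fn (Suc n) \<omega> x) \<in> borel_measurable (F (Suc n))" for n x
    using A5 by simp
  have adapted: "strongly_measurable (F n) (\<theta> n)" for n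
  proof (induction n)
    case 0
    show ?case
      using strongly_measurable_cong[of "F 0" "\<theta> 0" "\<lambda>_. \<theta>\<^sub>0"] init space_F
      by (simp add: strongly_measurable_const)
  next
    case (Suc n)
    have \<theta>n: "strongly_measurable (F (Suc n)) (\<theta> n)"
      by (rule strongly_measurable_subalgebra[OF mono Suc]) simp
    \<comment> \<open>Difference quotients show that \<open>X n\<close> is weakly measurable for \<open>F (Suc n)\<close>.\<close>
    have "strongly_measurable (F (Suc n)) (X n)"
    proof (rule strongly_measurable_if_weakly_measurable[OF sub])
      show "strongly_measurable M (X n)" using unbiased[of n] by (simp add: is_cond_exp_def)
      show "(\<lambda>\<omega>. inner h (X n \<omega>)) \<in> borel_measurable (F (Suc n))" for h
        unfolding X_def by (rule borel_measurable_inner_gradient[OF fn_meas _ \<theta>n]) (simp add: diff space_F)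
    qed
    then have "strongly_measurable (F (Suc n)) (\<lambda>\<omega>. \<theta> n \<omega> - \<gamma> 1 *\<^sub>R X n \<omega>)"
      by (intro strongly_measurable_diff strongly_measurable_scaleR \<theta>n borel_measurable_const)
    then show ?case
      using strongly_measurable_cong[of "F (Suc n)" "\<theta> (Suc n)"] recursion space_F by simp
  qed
  have X_bound: "AE \<omega> in M. norm (X n \<omega>) \<le> R" for n
    unfolding X_def
  proof (rule AE_norm_gradient_le[OF prob])
    show "(\<lambda>\<omega>. fn (Suc n) \<omega> x) \<in> borel_measurable M" for x
      using measurable_from_subalg[OF sub fn_meas] .
    show "strongly_measurable M (\<lambda>\<omega>. gradient (fn (Suc n) \<omega>) (\<theta> n \<omega>))"
      using unbiased[of n] by (simp add: is_cond_exp_def X_def[abs_def])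
  qed (use diff A4 R_pos strongly_measurable_subalgebra[OF sub adapted] in auto)
  interpret averaged_descent M F "\<lambda>n \<omega>. \<theta> n \<omega> - \<theta>opt" "\<lambda>n \<omega>. gradient f (\<theta> n \<omega>)" X "\<theta>\<^sub>0 - \<theta>opt" "\<gamma> 1" R N
  proof
    show "strongly_measurable (F n) (\<lambda>\<omega>. \<theta> n \<omega> - \<theta>opt)" for n
      by (intro strongly_measurable_diff adapted strongly_measurable_const)
    show "0 \<le> inner (gradient f (\<theta> n \<omega>)) (\<theta> n \<omega> - \<theta>opt)" for n \<omega>
      using gap_nonneg[of "\<theta> n \<omega> - \<theta>opt"] by (simp add: gap_def)
    show "\<theta> (Suc n) \<omega> - \<theta>opt = \<theta> n \<omega> - \<theta>opt - \<gamma> 1 *\<^sub>R X n \<omega>" if "\<omega> \<in> space M" for n \<omega>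
      using recursion[OF that] by simp
  qed (use sub mono step N R_pos unbiased X_bound A4 init in \<open>auto simp: is_cond_exp_def\<close>)
  define y where "y \<omega> = (1 / real N) *\<^sub>R (\<Sum>k<N. \<theta> k \<omega> - \<theta>opt)" for \<omega>
  have avg_eq: "avg \<omega> = \<theta>opt + y \<omega>" for \<omega>
  proof -
    have "{0..N - 1} = {..<N}" using N by auto
    then show ?thesis using N by (simp add: avg y_def sum_subtractf sum_constant_scaleR scaleR_diff_right)
  qed
  have bounds: "(norm (avg \<omega> - \<theta>opt))\<^sup>2 \<le> (deviation \<omega>)\<^sup>2 / \<mu>\<^sup>2"
    "f (avg \<omega>) - f \<theta>opt \<le> 3 / 2 * (deviation \<omega>)\<^sup>2 / \<mu>" for \<omega>
    using average_bounds[OF N_pos, of "\<lambda>k. \<theta> k \<omega> - \<theta>opt"]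
    unfolding avg_eq y_def by (simp_all add: deviation_def gap_def)
  have avg_meas: "strongly_measurable M avg"
    unfolding avg
    by (intro strongly_measurable_scaleR strongly_measurable_sum borel_measurable_const
        strongly_measurable_subalgebra[OF sub adapted])
  have "continuous_on UNIV f"
    using A1(2) by (intro differentiable_imp_continuous_on) (auto simp: differentiable_on_def three_times_differentiable_def)
  then have f_meas: "(\<lambda>\<omega>. f (avg \<omega>)) \<in> borel_measurable M"
    using strongly_measurable_continuous[OF avg_meas] by (simp flip: strongly_measurable_iff_borel_measurable)
  note dev = expectation_deviation_square
  have i_gap: "integrable M (\<lambda>\<omega>. f (avg \<omega>) - f \<theta>opt)"
  proof (rule Bochner_Integration.integrable_bound)
    show "integrable M (\<lambda>\<omega>. 3 / 2 * (deviation \<omega>)\<^sup>2 / \<mu>)" using dev(1) by simp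
    show "AE \<omega> in M. norm (f (avg \<omega>) - f \<theta>opt) \<le> norm (3 / 2 * (deviation \<omega>)\<^sup>2 / \<mu>)"
      using bounds(2) minimum by (intro AE_I2) (smt (verit) real_norm_def)
  qed (use f_meas in simp)
  then have i_f: "integrable M (\<lambda>\<omega>. f (avg \<omega>))"
    using Bochner_Integration.integrable_add[OF i_gap, of "\<lambda>_. f \<theta>opt"] by simp
  have i_norm: "integrable M (\<lambda>\<omega>. (norm (avg \<omega> - \<theta>opt))\<^sup>2)"
  proof (rule Bochner_Integration.integrable_bound)
    show "integrable M (\<lambda>\<omega>. (deviation \<omega>)\<^sup>2 / \<mu>\<^sup>2)" using dev(1) by simp
    show "(\<lambda>\<omega>. (norm (avg \<omega> - \<theta>opt))\<^sup>2) \<in> borel_measurable M"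
      by (intro borel_measurable_power borel_measurable_norm_strong strongly_measurable_diff avg_meas
          strongly_measurable_const)
    show "AE \<omega> in M. norm ((norm (avg \<omega> - \<theta>opt))\<^sup>2) \<le> norm ((deviation \<omega>)\<^sup>2 / \<mu>\<^sup>2)"
      using bounds(1) by (intro AE_I2) simp
  qed
  define D where "D = R * norm (\<theta>\<^sub>0 - \<theta>opt)"
  define P where "P = 300 * D ^ 4 + 1362 * D\<^sup>2 + 12 * D + 375"
  have D: "0 \<le> D" using R_pos by (simp add: D_def)
  have devP: "expectation (\<lambda>\<omega>. (deviation \<omega>)\<^sup>2) \<le> R\<^sup>2 / real N * P"
    using dev(2) by (simp add: D_def P_def)
  have "(\<integral>\<omega>. f (avg \<omega>) \<partial>M) - f \<theta>opt = expectation (\<lambda>\<omega>. f (avg \<omega>) - f \<theta>opt)"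
    using i_f prob_space by simp
  also have "\<dots> \<le> expectation (\<lambda>\<omega>. 3 / 2 * (deviation \<omega>)\<^sup>2 / \<mu>)"
    by (rule integral_mono[OF i_gap]) (use dev(1) bounds(2) in simp_all)
  also have "\<dots> = 3 / 2 / \<mu> * expectation (\<lambda>\<omega>. (deviation \<omega>)\<^sup>2)" by simp
  also have "\<dots> \<le> 3 / 2 / \<mu> * (R\<^sup>2 / real N * P)"
    using devP \<mu>_pos by (intro mult_left_mono) auto
  also have "\<dots> = R\<^sup>2 / (real N * \<mu>) * (3 / 2 * P)" by (simp add: mult_ac)
  also have "\<dots> \<le> R\<^sup>2 / (real N * \<mu>) * (5 * D + 15) ^ 4"
    unfolding P_def using averaged_bound_polynomials(1)[OF D] \<mu>_pos by (intro mult_left_mono) auto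
  finally have value_bound: "(\<integral>\<omega>. f (avg \<omega>) \<partial>M) - f \<theta>opt
      \<le> R\<^sup>2 / (real N * \<mu>) * (5 * R * norm (\<theta>\<^sub>0 - \<theta>opt) + 15) ^ 4"
    by (simp add: D_def mult.assoc)
  have "(\<integral>\<omega>. (norm (avg \<omega> - \<theta>opt))\<^sup>2 \<partial>M) \<le> expectation (\<lambda>\<omega>. (deviation \<omega>)\<^sup>2 / \<mu>\<^sup>2)"
    by (rule integral_mono[OF i_norm]) (use dev(1) bounds(1) in simp_all)
  also have "\<dots> = 1 / \<mu>\<^sup>2 * expectation (\<lambda>\<omega>. (deviation \<omega>)\<^sup>2)" by simp
  also have "\<dots> \<le> 1 / \<mu>\<^sup>2 * (R\<^sup>2 / real N * P)"
    using devP by (intro mult_left_mono) auto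
  also have "\<dots> = R\<^sup>2 / (real N * \<mu>\<^sup>2) * P" by simp
  also have "\<dots> \<le> R\<^sup>2 / (real N * \<mu>\<^sup>2) * (6 * D + 21) ^ 4"
    unfolding P_def using averaged_bound_polynomials(2)[OF D] by (intro mult_left_mono) auto
  finally have norm_bound: "(\<integral>\<omega>. (norm (avg \<omega> - \<theta>opt))\<^sup>2 \<partial>M)
      \<le> R\<^sup>2 / (real N * \<mu>\<^sup>2) * (6 * R * norm (\<theta>\<^sub>0 - \<theta>opt) + 21) ^ 4"
    by (simp add: D_def mult.assoc)
  show ?thesis using i_f i_norm value_bound norm_bound by blast
qed

end
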